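(* Let $X$ be a finite CW-complex and let $\omega$ be a continuous closed 1-form on $X$ representing a cohomology class $\xi=[\omega]\in H^1(X;\mathbf{R})$. Let $\varphi$ be a gradient-like flow of $\omega$ whose fixed point set $\operatorname{Fix}(\varphi^t)$ is a finite set $\{p_1,\dots,p_k\}$, where $k>0$ is an integer. If $k<\operatorname{cat}(X,\xi)$, then the flow $\varphi$ has a homoclinic cycle.
   Context: Continuous closed 1-form: a continuous closed 1-form $\omega$ on a topological space $X$ is a collection $\{f_U\}_{U\in\mathcal U}$ of continuous functions $f_U:U\to\mathbf{R}$, where $\mathcal U$ is an open cover of $X$, such that for all $U,V\in\mathcal U$ the function $f_U|_{U\cap V}-f_V|_{U\cap V}$ is locally constant on $U\cap V$. Two such forms $\{f_U\}_{U\in\mathcal U}$ and $\{g_V\}_{V\in\mathcal V}$ are equivalent if their union $\{f_U,g_V\}_{U\in\mathcal U,V\in\mathcal V}$ is again a continuous closed 1-form. Integral: for a continuous path $\gamma:[0,1]\to X$, choose a subdivision $0=t_0<t_1<\dots<t_N=1$ such that each $\gamma([t_i,t_{i+1}])$ lies in a single $U_i\in\mathcal U$, and put $\int_\gamma\omega=\sum_{i=0}^{N-1}[f_{U_i}(\gamma(t_{i+1}))-f_{U_i}(\gamma(t_i))]$; this is independent of choices and depends only on the homotopy class of $\gamma$ relative to its endpoints. The cohomology class $[\omega]\in H^1(X;\mathbf{R})=\operatorname{Hom}(H_1(X;\mathbf{Z}),\mathbf{R})$ is the one given by the homomorphism of periods $[\gamma]\mapsto\int_\gamma\omega$; one says $\omega$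 represents $[\omega]$. Flows: a continuous flow on $X$ is a continuous map $\varphi:X\times\mathbf{R}\to X$ with $\varphi(x,0)=x$ and $\varphi(\varphi(x,s),t)=\varphi(x,s+t)$; write $\varphi^t(x)=x\cdot t=\varphi(x,t)$. $\operatorname{Fix}(\varphi^t)$ is the set of points $x$ with $x\cdot t=x$ for all $t\in\mathbf{R}$. A gradient-like flow of $\omega=\{f_U\}_{U\in\mathcal U}$ is a continuous flow $\varphi$ on $X$ such that for each $U\in\mathcal U$, on $U-(\operatorname{Fix}(\varphi^t)\cap U)$ the function $f_U$ is a strict Lyapunov function, i.e. $f_U$ is strictly decreasing along (the portions in $U$ of) the non-constant trajectories of the flow. Homoclinic cycle: a homoclinic cycle (of length $n\ge1$) of a flow $\varphi$ is a sequence of non-constant trajectories $\gamma_1,\dots,\gamma_n:\mathbf{R}\to X$, $\gamma_i(t)=x_i\cdot t$, and points $p_1,\dots,p_n$ such that $\lim_{t\to+\infty}\gamma_i(t)=p_{i+1}=\lim_{t\to-\infty}\gamma_{i+1}(t)$ for $i=1,\dots,n-1$ and $\lim_{t\to+\infty}\gamma_n(t)=p_1=\lim_{t\to-\infty}\gamma_1(t)$. (The points in this definition are not related to the labelling of the fixed points in the claim.) Category: for a finite CW-complex $X$ and $\xi\in H^1(X;\mathbf{R})$, $\operatorname{cat}(X,\xi)$ is the least integer $k\ge 0$ such that for every integer $N>0$ there is an open cover $X=F\cup F_1\cup\dots\cup F_k$ such that (a) each inclusion $F_j\to X$, $j=1,\dots,k$, is null-homotopic; (b) there is a homotopy $h_t:F\to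 X$, $t\in[0,1]$, with $h_0$ the inclusion $F\to X$, such that for every $x\in F$ one has $\int_{\gamma_x}\omega\le -N$, where $\gamma_x(t)=h_t(x)$ and $\omega$ is a continuous closed 1-form representing $\xi$ (the number does not depend on the choice of $\omega$). The set $F$ may be empty. *)

theory Defs
  imports "HOL-Homology.Homology"
begin

definition unit_disc :: "nat \<Rightarrow> (nat \<Rightarrow> real) set" where
  "unit_disc n = {x \<in> topspace (Euclidean_space n). (\<Sum>i<n. (x i)\<^sup>2) \<le> 1}"

definition open_unit_disc :: "nat \<Rightarrow> (nat \<Rightarrow> real) set" where
  "open_unit_disc n = {x \<in> topspace (Euclidean_space n). (\<Sum>i<n. (x i)\<^sup>2) < 1}"

text \<open>
  The cells are indexed by \<open>i < m\<close>; the \<open>i\<close>-th one has dimension \<open>d i\<close> and characteristic map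
  \<open>\<Phi> i\<close>.  The requirement that \<open>X\<close> carry the weak topology is not listed, because it is automatic
  here: the closed cells are compact, hence closed in the Hausdorff space \<open>X\<close>, and there are only
  finitely many of them.
\<close>
definition finite_CW_complex :: "'a topology \<Rightarrow> bool" where
  "finite_CW_complex X \<longleftrightarrow>
     Hausdorff_space X \<and>
     (\<exists>(m :: nat) (d :: nat \<Rightarrow> nat) (\<Phi> :: nat \<Rightarrow> (nat \<Rightarrow> real) \<Rightarrow> 'a).
        (\<forall>i<m. continuous_map (subtopology (Euclidean_space (d i)) (unit_disc (d i))) X (\<Phi> i)) \<and>
        (\<forall>i<m. embedding_map (subtopology (Euclidean_space (d i)) (open_unit_disc (d i))) X (\<Phi> i)) \<and>
        (\<forall>i<m. \<forall>j<m. i \<noteq> j \<longrightarrow>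
           disjnt (\<Phi> i ` open_unit_disc (d i)) (\<Phi> j ` open_unit_disc (d j))) \<and>
        topspace X = (\<Union>i<m. \<Phi> i ` open_unit_disc (d i)) \<and>
        (\<forall>i<m. \<Phi> i ` (unit_disc (d i) - open_unit_disc (d i)) \<subseteq>
           (\<Union>j\<in>{j. j < m \<and> d j < d i}. \<Phi> j ` open_unit_disc (d j))))"

definition locally_constant_on :: "'a topology \<Rightarrow> 'a set \<Rightarrow> ('a \<Rightarrow> 'b) \<Rightarrow> bool" where
  "locally_constant_on X S g \<longleftrightarrow>
     (\<forall>x\<in>S. \<exists>W. openin (subtopology X S) W \<and> x \<in> W \<and> (\<forall>y\<in>W. g y = g x))"

text \<open>
  A form \<open>{f\<^sub>U}\<close> is the set of the pairs \<open>(U, f\<^sub>U)\<close>; only the values of \<open>f\<^sub>U\<close> on \<open>U\<close> matter.  The same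
  open set may occur with several functions, as it does in the union of two forms over a common
  cover.
\<close>
type_synonym 'a form = "('a set \<times> ('a \<Rightarrow> real)) set"

definition closed_form :: "'a topology \<Rightarrow> 'a form \<Rightarrow> bool" where
  "closed_form X \<omega> \<longleftrightarrow>
     (\<forall>(U, f)\<in>\<omega>. openin X U \<and> continuous_map (subtopology X U) euclideanreal f) \<and>
     topspace X = (\<Union>(U, f)\<in>\<omega>. U) \<and>
     (\<forall>(U, f)\<in>\<omega>. \<forall>(V, g)\<in>\<omega>. locally_constant_on X (U \<inter> V) (\<lambda>x. f x - g x))"

definition has_form_integral :: "'a form \<Rightarrow> (real \<Rightarrow> 'a) \<Rightarrow> real \<Rightarrow> bool" where
  "has_form_integral \<omega> \<gamma> I \<longleftrightarrow>
     (\<exists>(N :: nat) (t :: nat \<Rightarrow> real) (U :: nat \<Rightarrow> 'a set) (f :: nat \<Rightarrow> 'a \<Rightarrow> real).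
        t 0 = 0 \<and> t N = 1 \<and> (\<forall>i<N. t i < t (Suc i)) \<and>
        (\<forall>i<N. (U i, f i) \<in> \<omega> \<and> \<gamma> ` {t i..t (Suc i)} \<subseteq> U i) \<and>
        I = (\<Sum>i<N. f i (\<gamma> (t (Suc i))) - f i (\<gamma> (t i))))"

definition form_integral :: "'a form \<Rightarrow> (real \<Rightarrow> 'a) \<Rightarrow> real" where
  "form_integral \<omega> \<gamma> = (THE I. has_form_integral \<omega> \<gamma> I)"

definition real_group :: "real monoid" where
  "real_group = \<lparr>carrier = UNIV, monoid.mult = (+), one = 0\<rparr>"

definition loop_in :: "'a topology \<Rightarrow> (real \<Rightarrow> 'a) \<Rightarrow> bool" where
  "loop_in X \<gamma> \<longleftrightarrow> pathin X \<gamma> \<and> \<gamma> 0 = \<gamma> 1"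

text \<open>
  The class in \<open>H\<^sub>1(X; \<int>)\<close> of a loop.  The coordinate \<open>v 1\<close> identifies the standard 1-simplex with the
  unit interval, vertex 0 going to 0 and vertex 1 to 1.
\<close>
definition loop_class :: "'a topology \<Rightarrow> (real \<Rightarrow> 'a) \<Rightarrow> 'a chain set" where
  "loop_class X \<gamma> =
     homologous_rel_set 1 X {} (frag_of (restrict (\<lambda>v. \<gamma> (v 1)) (standard_simplex 1)))"

definition real_cohomology1 :: "'a topology \<Rightarrow> ('a chain set \<Rightarrow> real) set" where
  "real_cohomology1 X = hom (homology_group 1 X) real_group"

text \<open>
  \<open>\<xi> = [\<omega>]\<close>.  As the classes of loops generate \<open>H\<^sub>1(X; \<int>)\<close>, this determines \<open>\<xi>\<close> on the whole group.
\<close>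
definition represents :: "'a topology \<Rightarrow> 'a form \<Rightarrow> ('a chain set \<Rightarrow> real) \<Rightarrow> bool" where
  "represents X \<omega> \<xi> \<longleftrightarrow>
     closed_form X \<omega> \<and> \<xi> \<in> real_cohomology1 X \<and>
     (\<forall>\<gamma>. loop_in X \<gamma> \<longrightarrow> \<xi> (loop_class X \<gamma>) = form_integral \<omega> \<gamma>)"

definition continuous_flow :: "'a topology \<Rightarrow> ('a \<times> real \<Rightarrow> 'a) \<Rightarrow> bool" where
  "continuous_flow X \<phi> \<longleftrightarrow>
     continuous_map (prod_topology X euclideanreal) X \<phi> \<and>
     (\<forall>x\<in>topspace X. \<phi> (x, 0) = x) \<and>
     (\<forall>x\<in>topspace X. \<forall>s t. \<phi> (\<phi> (x, s), t) = \<phi> (x, s + t))"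

definition flow_fix :: "'a topology \<Rightarrow> ('a \<times> real \<Rightarrow> 'a) \<Rightarrow> 'a set" where
  "flow_fix X \<phi> = {x \<in> topspace X. \<forall>t. \<phi> (x, t) = x}"

text \<open>
  A non-constant trajectory may leave \<open>U\<close> and return to it at a higher value of \<open>f\<^sub>U\<close>; the function has
  to decrease on each time interval that the trajectory spends inside \<open>U\<close>.
\<close>
definition gradient_like :: "'a topology \<Rightarrow> 'a form \<Rightarrow> ('a \<times> real \<Rightarrow> 'a) \<Rightarrow> bool" where
  "gradient_like X \<omega> \<phi> \<longleftrightarrow>
     continuous_flow X \<phi> \<and>
     (\<forall>(U, f)\<in>\<omega>. \<forall>x\<in>topspace X - flow_fix X \<phi>. \<forall>s t.
        s < t \<and> (\<forall>r\<in>{s..t}. \<phi> (x, r) \<in> U) \<longrightarrow> f (\<phi> (x, t)) < f (\<phi> (x, s)))"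

definition homoclinic_cycle ::
  "'a topology \<Rightarrow> ('a \<times> real \<Rightarrow> 'a) \<Rightarrow> nat \<Rightarrow> (nat \<Rightarrow> 'a) \<Rightarrow> (nat \<Rightarrow> 'a) \<Rightarrow> bool" where
  "homoclinic_cycle X \<phi> n x p \<longleftrightarrow>
     1 \<le> n \<and>
     (\<forall>i\<in>{1..n}. x i \<in> topspace X - flow_fix X \<phi>) \<and>
     (\<forall>i\<in>{1..<n}. limitin X (\<lambda>t. \<phi> (x i, t)) (p (i + 1)) at_top \<and>
                  limitin X (\<lambda>t. \<phi> (x (i + 1), t)) (p (i + 1)) at_bot) \<and>
     limitin X (\<lambda>t. \<phi> (x n, t)) (p 1) at_top \<and>
     limitin X (\<lambda>t. \<phi> (x 1, t)) (p 1) at_bot"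

definition null_homotopic_in :: "'a topology \<Rightarrow> 'a set \<Rightarrow> bool" where
  "null_homotopic_in X S \<longleftrightarrow>
     (\<exists>c. homotopic_with (\<lambda>_. True) (subtopology X S) X id (\<lambda>_. c))"

definition movable_below :: "'a topology \<Rightarrow> 'a form \<Rightarrow> real \<Rightarrow> 'a set \<Rightarrow> bool" where
  "movable_below X \<omega> N F \<longleftrightarrow>
     (\<exists>h. continuous_map (prod_topology (top_of_set {0..1}) (subtopology X F)) X h \<and>
          (\<forall>x\<in>F. h (0, x) = x) \<and>
          (\<forall>x\<in>F. form_integral \<omega> (\<lambda>t. h (t, x)) \<le> - N))"

text \<open>
  The choice of the representative \<open>\<omega>\<close> of \<open>\<xi>\<close> is immaterial: if two forms on the compact space \<open>X\<close>
  represent the same class, their integrals over paths differ by a bounded amount.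
\<close>
definition cat_class :: "'a topology \<Rightarrow> ('a chain set \<Rightarrow> real) \<Rightarrow> nat" where
  "cat_class X \<xi> =
     (LEAST k. \<exists>\<omega>. represents X \<omega> \<xi> \<and>
        (\<forall>N::nat. N > 0 \<longrightarrow>
           (\<exists>F (G :: nat \<Rightarrow> 'a set).
              openin X F \<and> (\<forall>j\<in>{1..k}. openin X (G j)) \<and>
              topspace X = F \<union> (\<Union>j\<in>{1..k}. G j) \<and>
              (\<forall>j\<in>{1..k}. null_homotopic_in X (G j)) \<and>
              movable_below X \<omega> (real N) F)))"

end

theory Submission
  imports Defs "HOL-Analysis.Abstract_Topological_Spaces"
begin

text \<open>
  Let \<open>A x t\<close> be the integral of \<open>\<omega>\<close> along \<open>r \<mapsto> x \<cdot> r\<close>, \<open>0 \<le> r \<le> t\<close>: a continuous cocycle, strictly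
  decreasing in \<open>t\<close> off the fixed points.  Given \<open>N\<close>, the flow itself moves the open set
  \<open>F = {x. \<exists>t\<ge>0. A x t < -N}\<close> down by \<open>N\<close>, and by compactness every point outside \<open>F\<close> converges to a fixed
  point.  If there is no homoclinic cycle, the relation "some non-constant trajectory runs from \<open>p\<close>
  to \<open>q\<close>" is acyclic on the finite set of fixed points, and well-founded induction along it shows
  that a trajectory leaving a small neighbourhood \<open>W\<close> of a fixed point \<open>p\<close> cannot come back close to \<open>p\<close>
  at a cost \<open>\<le> N + 1\<close>.  Hence on the set \<open>G\<close> of the points that come close to \<open>p\<close> at such a cost, a primitive
  of \<open>\<omega>\<close> near \<open>p\<close> extends along trajectories; the time at which this extension falls to a small
  value is continuous, so the flow deforms \<open>G\<close> into \<open>W\<close>, which may be taken null-homotopic.  Thus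
  \<open>F\<close> and one such set for each fixed point show \<open>cat(X, \<xi>) \<le> k\<close>.
\<close>

section \<open>Integrals of closed forms along trajectories\<close>

text \<open>A trajectory may come back near \<open>p\<close>, and the values which the two visits
  assign to a primitive of \<omega> differ in general, so the basin of \<open>p\<close> carries no
  single-valued height. \<open>no_return\<close> removes this obstacle, but only up to a prescribed
  cost, which is all that a given N asks for. It has to be proved for pairs (p, q): a trajectory
  that leaves \<open>p\<close> may linger at another fixed point \<open>p'\<close>, and what is
  needed there is a statement about reaching \<open>q\<close> from \<open>p'\<close>. The target
  stays fixed while the source moves along connections. The set of points converging to
  \<open>p\<close> need not be open. The sets \<open>G\<close> are therefore cut out by a condition
  at a single finite time, nearness to \<open>p\<close> at bounded cost; relaxing N to N + 1 makes
  it an open condition that still includes the whole part of the basin with cost at most N. The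
  first time at which a point enters \<open>W\<close> need not depend continuously on the point. The
  time at which a strictly decreasing function crosses a level does, hence the detour through an
  extended primitive; a lower bound for the cost of entering \<open>W\<close> from outside then
  shows that the crossing takes place inside \<open>W\<close>.\<close>

definition primitive_along :: "'a form \<Rightarrow> (real \<Rightarrow> 'a) \<Rightarrow> real set \<Rightarrow> (real \<Rightarrow> real) \<Rightarrow> bool" where
  "primitive_along \<omega> \<gamma> A P \<longleftrightarrow>
     (\<forall>r\<in>A. \<forall>(U, f)\<in>\<omega>. \<gamma> r \<in> U \<longrightarrow>
        (\<forall>\<^sub>F s in at r within A. P s - f (\<gamma> s) = P r - f (\<gamma> r)))"

lemma primitive_alongD:
  "\<lbrakk>primitive_along \<omega> \<gamma> A P; r \<in> A; (U, f) \<in> \<omega>; \<gamma> r \<in> U\<rbrakk>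
   \<Longrightarrow> \<forall>\<^sub>F s in at r within A. P s - f (\<gamma> s) = P r - f (\<gamma> r)"
  unfolding primitive_along_def by blast

lemma eventually_path_in_open:
  assumes "continuous_map euclideanreal X \<gamma>" "openin X W" "\<gamma> r \<in> W"
  shows "\<forall>\<^sub>F s in at r within A. \<gamma> s \<in> W"
proof -
  have "open {s. \<gamma> s \<in> W}"
    using openin_continuous_map_preimage[OF assms(1,2)] by simp
  then show ?thesis
    using assms(3) by (auto simp: eventually_at_topological)
qed

lemma closed_form_open: "\<lbrakk>closed_form X \<omega>; (U, f) \<in> \<omega>\<rbrakk> \<Longrightarrow> openin X U"
  and closed_form_continuous:
    "\<lbrakk>closed_form X \<omega>; (U, f) \<in> \<omega>\<rbrakk> \<Longrightarrow> continuous_map (subtopology X U) euclideanreal f"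
  unfolding closed_form_def by blast+

lemma closed_form_cover:
  assumes "closed_form X \<omega>" "x \<in> topspace X"
  obtains U f where "(U, f) \<in> \<omega>" "x \<in> U"
  using assms unfolding closed_form_def by fastforce

lemma closed_form_locally_const:
  assumes "closed_form X \<omega>" "(U, f) \<in> \<omega>" "(V, g) \<in> \<omega>" "x \<in> U" "x \<in> V"
  obtains W where "openin X W" "x \<in> W" "\<And>y. y \<in> W \<Longrightarrow> y \<in> U \<and> y \<in> V \<and> f y - g y = f x - g x"
proof -
  have "locally_constant_on X (U \<inter> V) (\<lambda>x. f x - g x)"
    using assms unfolding closed_form_def by blast
  then obtain W where W: "openin (subtopology X (U \<inter> V)) W" "x \<in> W" "\<forall>y\<in>W. f y - g y = f x - g x"
    using assms unfolding locally_constant_on_def by blast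
  moreover have "openin X (U \<inter> V)"
    using closed_form_open[OF assms(1,2)] closed_form_open[OF assms(1,3)] by blast
  ultimately have "openin X W" "W \<subseteq> U \<inter> V"
    by (auto simp: openin_open_subtopology)
  with W that show thesis by blast
qed

text \<open>Two charts at a point differ by a locally constant function, so testing one chart per
  time is enough, although \<open>primitive_along\<close> quantifies over all of them. Working with
  germs in \<open>at r within A\<close> lets primitives be restricted, glued and reparametrised
  without choosing a subdivision.\<close>

lemma primitive_alongI:
  assumes "continuous_map euclideanreal X \<gamma>" "closed_form X \<omega>"
    and "\<And>r. r \<in> A \<Longrightarrow> \<exists>U f. (U, f) \<in> \<omega> \<and> \<gamma> r \<in> U \<and>
           (\<forall>\<^sub>F s in at r within A. P s - f (\<gamma> s) = P r - f (\<gamma> r))"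
  shows "primitive_along \<omega> \<gamma> A P"
  unfolding primitive_along_def
proof (clarify)
  fix r V g assume r: "r \<in> A" and V: "(V, g) \<in> \<omega>" "\<gamma> r \<in> V"
  obtain U f where U: "(U, f) \<in> \<omega>" "\<gamma> r \<in> U"
    and ev: "\<forall>\<^sub>F s in at r within A. P s - f (\<gamma> s) = P r - f (\<gamma> r)"
    using assms(3)[OF r] by blast
  obtain W where W: "openin X W" "\<gamma> r \<in> W"
    "\<And>y. y \<in> W \<Longrightarrow> y \<in> U \<and> y \<in> V \<and> f y - g y = f (\<gamma> r) - g (\<gamma> r)"
    using closed_form_locally_const[OF assms(2) U(1) V(1) U(2) V(2)] by metis
  show "\<forall>\<^sub>F s in at r within A. P s - g (\<gamma> s) = P r - g (\<gamma> r)"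
    using ev eventually_path_in_open[OF assms(1) W(1,2)]
  proof eventually_elim
    case (elim s)
    then show ?case using W(3)[of "\<gamma> s"] by linarith
  qed
qed

lemma primitive_along_mono:
  "\<lbrakk>primitive_along \<omega> \<gamma> A P; B \<subseteq> A\<rbrakk> \<Longrightarrow> primitive_along \<omega> \<gamma> B P"
  unfolding primitive_along_def by (blast intro: filter_leD[OF at_le])

lemma primitive_along_local:
  assumes "primitive_along \<omega> \<gamma> A P" "(U, f) \<in> \<omega>" "\<gamma> ` A \<subseteq> U" "connected A" "s \<in> A" "t \<in> A"
  shows "P t - P s = f (\<gamma> t) - f (\<gamma> s)"
proof -
  have "(\<lambda>s. P s - f (\<gamma> s)) s = (\<lambda>s. P s - f (\<gamma> s)) t"
  proof (rule connected_local_const[OF assms(4-6)], rule ballI)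
    fix a assume "a \<in> A"
    then show "\<forall>\<^sub>F b in at a within A. P a - f (\<gamma> a) = P b - f (\<gamma> b)"
      using primitive_alongD[OF assms(1) _ assms(2), of a] assms(3)
      by (auto simp: eq_commute image_subset_iff)
  qed
  then show ?thesis by simp
qed

text \<open>Inside one chart \<open>\<lambda>s. f (\<gamma> s)\<close> is itself a primitive, and
  primitives on adjacent intervals glue; the bisection principle \<open>Bolzano\<close> does the
  rest.\<close>

lemma primitive_along_exists:
  assumes \<gamma>: "continuous_map euclideanreal X \<gamma>" and \<omega>: "closed_form X \<omega>" and ab: "a \<le> b"
  shows "\<exists>P. primitive_along \<omega> \<gamma> {a..b} P"
  using ab
proof (induction rule: Bolzano)
  case (trans a b c)
  then obtain P Q where P: "primitive_along \<omega> \<gamma> {a..b} P" and Q: "primitive_along \<omega> \<gamma> {b..c} Q"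
    by blast
  \<comment> \<open>The shift makes \<open>Q\<close> agree with \<open>P\<close> at
    \<open>b\<close>. The germs at \<open>r\<close> from \<open>{a..b}\<close> and from
    \<open>{b..c}\<close> are then treated separately; if \<open>r \<noteq> b\<close>, one of them
    is trivial.\<close>
  define R where "R = (\<lambda>s. if s \<le> b then P s else Q s + (P b - Q b))"
  have RQ: "R s = Q s + (P b - Q b)" if "s \<ge> b" for s
    using that by (auto simp: R_def)
  have RP: "R s = P s" if "s \<le> b" for s
    using that by (auto simp: R_def)
  have "primitive_along \<omega> \<gamma> {a..c} R"
    unfolding primitive_along_def
  proof clarify
    fix r U f assume r: "r \<in> {a..c}" and U: "(U, f) \<in> \<omega>" "\<gamma> r \<in> U"
    have "\<forall>\<^sub>F s in at r within {a..b}. R s - f (\<gamma> s) = R r - f (\<gamma> r)"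
    proof (cases "r \<le> b")
      case True
      have "\<forall>\<^sub>F s in at r within {a..b}. s \<in> {a..b}"
        by (simp add: eventually_at_filter)
      moreover have "\<forall>\<^sub>F s in at r within {a..b}. P s - f (\<gamma> s) = P r - f (\<gamma> r)"
        using primitive_alongD[OF P _ U] True r by auto
      ultimately show ?thesis
        by eventually_elim (use True in \<open>simp add: RP\<close>)
    next
      case False
      then show ?thesis
        by (auto simp: eventually_at intro!: exI[of _ "r - b"] simp: dist_real_def)
    qed
    moreover
    have "\<forall>\<^sub>F s in at r within {b..c}. R s - f (\<gamma> s) = R r - f (\<gamma> r)"
    proof (cases "b \<le> r")
      case True
      have "\<forall>\<^sub>F s in at r within {b..c}. s \<in> {b..c}"
        by (simp add: eventually_at_filter)
      moreover have "\<forall>\<^sub>F s in at r within {b..c}. Q s - f (\<gamma> s) = Q r - f (\<gamma> r)"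
        using primitive_alongD[OF Q _ U] True r by auto
      ultimately show ?thesis
        by eventually_elim (use True in \<open>simp add: RQ\<close>)
    next
      case False
      then show ?thesis
        by (auto simp: eventually_at intro!: exI[of _ "b - r"] simp: dist_real_def)
    qed
    moreover have "{a..c} = {a..b} \<union> {b..c}"
      using trans by auto
    ultimately show "\<forall>\<^sub>F s in at r within {a..c}. R s - f (\<gamma> s) = R r - f (\<gamma> r)"
      by (simp add: at_within_union eventually_sup)
  qed
  then show ?case by blast
next
  case (local x)
  have "\<gamma> x \<in> topspace X"
    using \<gamma> by (auto simp: continuous_map_def)
  then obtain U f where U: "(U, f) \<in> \<omega>" "\<gamma> x \<in> U"
    using closed_form_cover[OF \<omega>] by blast
  have "open {s. \<gamma> s \<in> U}"
    using openin_continuous_map_preimage[OF \<gamma> closed_form_open[OF \<omega> U(1)]] by simp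
  then obtain d where d: "d > 0" "ball x d \<subseteq> {s. \<gamma> s \<in> U}"
    using U(2) by (auto simp: open_contains_ball)
  have "primitive_along \<omega> \<gamma> {a..b} (\<lambda>s. f (\<gamma> s))" if "a \<le> x" "x \<le> b" "b - a < d" for a b
  proof (rule primitive_alongI[OF \<gamma> \<omega>])
    fix r assume "r \<in> {a..b}"
    then have "\<gamma> r \<in> U" using d that by (auto simp: subset_iff dist_real_def)
    with U show "\<exists>U g. (U, g) \<in> \<omega> \<and> \<gamma> r \<in> U \<and>
       (\<forall>\<^sub>F s in at r within {a..b}. f (\<gamma> s) - g (\<gamma> s) = f (\<gamma> r) - g (\<gamma> r))"
      by (intro exI[of _ U] exI[of _ f]) auto
  qed
  with d show ?case by blast
qed

text \<open>A Lebesgue number of the cover of \<open>{0..1}\<close> by preimages of charts permits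
  equal steps. These explicit division points are reused for all nearby trajectories in
  \<open>flow_integral_continuous\<close>.\<close>

lemma subordinate_subdivision:
  assumes \<gamma>: "continuous_map euclideanreal X \<gamma>" and \<omega>: "closed_form X \<omega>"
  obtains N U f where "N > 0" "\<And>i. i < N \<Longrightarrow> (U i, f i) \<in> \<omega>"
    "\<And>i. i < N \<Longrightarrow> \<gamma> ` {real i / real N..real (Suc i) / real N} \<subseteq> U i"
proof -
  let ?G = "(\<lambda>(U, f). {s. \<gamma> s \<in> U}) ` \<omega>"
  have "{0..1} \<subseteq> \<Union>?G"
  proof
    fix s :: real
    have "\<gamma> s \<in> topspace X" using \<gamma> by (auto simp: continuous_map_def)
    then obtain U f where "(U, f) \<in> \<omega>" "\<gamma> s \<in> U" using closed_form_cover[OF \<omega>] by blast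
    then show "s \<in> \<Union>?G" by (intro UnionI[of "{s. \<gamma> s \<in> U}"]) force+
  qed
  moreover have "open S" if "S \<in> ?G" for S
    using that openin_continuous_map_preimage[OF \<gamma> closed_form_open[OF \<omega>]] by auto
  ultimately obtain e where e: "e > 0" "\<forall>x\<in>{0..1::real}. \<exists>S\<in>?G. ball x e \<subseteq> S"
    using Heine_Borel_lemma[OF compact_Icc, of 0 1 ?G] by metis
  obtain N where N: "N > 0" "1 / real N < e"
    using e(1) by (metis nat_approx_posE zero_less_Suc)
  have "\<exists>U f. (U, f) \<in> \<omega> \<and> \<gamma> ` {real i / real N..real (Suc i) / real N} \<subseteq> U" if i: "i < N" for i
  proof -
    have "real i / real N \<in> {0..1}" using i by auto
    then obtain U f where U: "(U, f) \<in> \<omega>" "ball (real i / real N) e \<subseteq> {s. \<gamma> s \<in> U}"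
      using e(2) by fastforce
    moreover have "{real i / real N..real (Suc i) / real N} \<subseteq> ball (real i / real N) e"
      using N by (auto simp: dist_real_def add_divide_distrib)
    ultimately show ?thesis by (intro exI[of _ U] exI[of _ f]) auto
  qed
  then obtain U f where "\<And>i. i < N \<Longrightarrow> (U i, f i) \<in> \<omega> \<and> \<gamma> ` {real i / real N..real (Suc i) / real N} \<subseteq> U i"
    by metis
  with N that show thesis by blast
qed

lemma primitive_along_sum:
  fixes t :: "nat \<Rightarrow> real"
  assumes P: "primitive_along \<omega> \<gamma> {t 0..t N} P"
    and t: "\<And>i. i < N \<Longrightarrow> t i \<le> t (Suc i)"
    and U: "\<And>i. i < N \<Longrightarrow> (U i, f i) \<in> \<omega>" "\<And>i. i < N \<Longrightarrow> \<gamma> ` {t i..t (Suc i)} \<subseteq> U i"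
  shows "(\<Sum>i<N. f i (\<gamma> (t (Suc i))) - f i (\<gamma> (t i))) = P (t N) - P (t 0)"
proof -
  have mono: "t i \<le> t j" if "i \<le> j" "j \<le> N" for i j
    using that
  proof (induction j rule: dec_induct)
    case (step n)
    then show ?case using t[of n] by simp
  qed simp
  have "f i (\<gamma> (t (Suc i))) - f i (\<gamma> (t i)) = P (t (Suc i)) - P (t i)" if i: "i < N" for i
  proof -
    have "primitive_along \<omega> \<gamma> {t i..t (Suc i)} P"
      by (rule primitive_along_mono[OF P]) (use mono[of 0 i] mono[of "Suc i" N] i in auto)
    then show ?thesis
      using primitive_along_local[OF _ U(1)[OF i] U(2)[OF i]] t[OF i] by fastforce
  qed
  then have "(\<Sum>i<N. f i (\<gamma> (t (Suc i))) - f i (\<gamma> (t i))) = (\<Sum>i<N. P (t (Suc i)) - P (t i))"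
    by simp
  also have "\<dots> = P (t N) - P (t 0)"
    by (rule sum_lessThan_telescope)
  finally show ?thesis .
qed

text \<open>\<open>primitive_along_sum\<close> evaluates every admissible sum to
  \<open>P 1 - P 0\<close>, which gives the uniqueness behind \<open>THE\<close>; an equal
  subdivision gives existence.\<close>

lemma form_integral_eq:
  assumes \<gamma>: "continuous_map euclideanreal X \<gamma>" and \<omega>: "closed_form X \<omega>"
    and P: "primitive_along \<omega> \<gamma> {0..1} P"
  shows "form_integral \<omega> \<gamma> = P 1 - P 0"
proof -
  have unique: "I = P 1 - P 0" if I: "has_form_integral \<omega> \<gamma> I" for I
  proof -
    obtain N t U f where *: "t 0 = 0" "t N = 1" "\<forall>i<N. t i < t (Suc i)"
        "\<forall>i<N. (U i, f i) \<in> \<omega> \<and> \<gamma> ` {t i..t (Suc i)} \<subseteq> U i"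
        "I = (\<Sum>i<N. f i (\<gamma> (t (Suc i))) - f i (\<gamma> (t i)))"
      using I unfolding has_form_integral_def by blast
    then show ?thesis
      using primitive_along_sum[of \<omega> \<gamma> t N P U f] P by (auto simp: less_imp_le)
  qed
  obtain N U f where N: "N > 0" "\<And>i. i < N \<Longrightarrow> (U i, f i) \<in> \<omega>"
    "\<And>i. i < N \<Longrightarrow> \<gamma> ` {real i / real N..real (Suc i) / real N} \<subseteq> U i"
    using subordinate_subdivision[OF \<gamma> \<omega>] by metis
  have "has_form_integral \<omega> \<gamma> (\<Sum>i<N. f i (\<gamma> (real (Suc i) / real N)) - f i (\<gamma> (real i / real N)))"
    unfolding has_form_integral_def
    by (intro exI[of _ N] exI[of _ "\<lambda>i. real i / real N"] exI[of _ U] exI[of _ f])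
       (use N in \<open>auto simp: divide_strict_right_mono\<close>)
  with unique show ?thesis
    unfolding form_integral_def by (metis (no_types, lifting) theI)
qed

text \<open>The factor \<open>t\<close> fits the trajectory piece to the unit interval and reverses
  it for \<open>t < 0\<close>, so the cocycle identity holds for all real times. The paths have the
  same shape as those of the homotopy \<open>\<phi> (x, r * \<tau> x)\<close> used later.\<close>

definition flow_integral :: "'a form \<Rightarrow> ('a \<times> real \<Rightarrow> 'a) \<Rightarrow> 'a \<Rightarrow> real \<Rightarrow> real" where
  "flow_integral \<omega> \<phi> x t = form_integral \<omega> (\<lambda>r. \<phi> (x, r * t))"

lemma continuous_flow_path:
  assumes "continuous_flow X \<phi>" "x \<in> topspace X" "continuous_on UNIV \<tau>"
  shows "continuous_map euclideanreal X (\<lambda>r. \<phi> (x, \<tau> r))"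
proof -
  have "continuous_map euclideanreal (prod_topology X euclideanreal) (\<lambda>r. (x, \<tau> r))"
    using assms by (intro continuous_map_pairedI) auto
  then show ?thesis
    using assms continuous_map_compose[of _ _ _ X \<phi>] unfolding continuous_flow_def o_def by blast
qed

lemma primitive_along_scale:
  assumes P: "primitive_along \<omega> \<gamma> A P"
    and \<gamma>: "\<And>s. \<delta> s = \<gamma> (a + s * t)" and B: "\<And>s. s \<in> B \<Longrightarrow> a + s * t \<in> A"
  shows "primitive_along \<omega> \<delta> B (\<lambda>s. P (a + s * t))"
  unfolding primitive_along_def
proof clarify
  fix r U f assume r: "r \<in> B" and U: "(U, f) \<in> \<omega>" "\<delta> r \<in> U"
  have ev: "\<forall>\<^sub>F s in at (a + r * t) within A. P s - f (\<gamma> s) = P (a + r * t) - f (\<gamma> (a + r * t))"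
    using primitive_alongD[OF P B[OF r] U(1)] U(2) by (simp add: \<gamma>)
  have lim: "((\<lambda>s. a + s * t) \<longlongrightarrow> a + r * t) (at r within B)"
    by (intro tendsto_intros)
  obtain S where S: "open S" "a + r * t \<in> S"
    "\<forall>s\<in>S. s \<in> A \<longrightarrow> P s - f (\<gamma> s) = P (a + r * t) - f (\<gamma> (a + r * t))"
    using ev unfolding eventually_at_topological by (metis (no_types, lifting))
  have "\<forall>\<^sub>F s in at r within B. s \<in> B"
    by (simp add: eventually_at_filter)
  moreover have "\<forall>\<^sub>F s in at r within B. a + s * t \<in> S"
    using lim S topological_tendstoD by blast
  ultimately show "\<forall>\<^sub>F s in at r within B. P (a + s * t) - f (\<delta> s) = P (a + r * t) - f (\<delta> r)"
    unfolding \<gamma> by eventually_elim (use B S in blast)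
qed

lemma flow_integral_primitive:
  assumes \<phi>: "continuous_flow X \<phi>" and \<omega>: "closed_form X \<omega>" and x: "x \<in> topspace X"
    and P: "primitive_along \<omega> (\<lambda>s. \<phi> (x, s)) {-T..T} P" and t: "\<bar>t\<bar> \<le> T"
  shows "flow_integral \<omega> \<phi> x t = P t - P 0"
proof -
  have "primitive_along \<omega> (\<lambda>r. \<phi> (x, r * t)) {0..1} (\<lambda>s. P (0 + s * t))"
  proof (rule primitive_along_scale[OF P])
    fix s :: real assume "s \<in> {0..1}"
    then have "\<bar>s * t\<bar> \<le> 1 * \<bar>t\<bar>"
      unfolding abs_mult by (intro mult_right_mono) auto
    then show "0 + s * t \<in> {-T..T}" using t by auto
  qed auto
  from form_integral_eq[OF continuous_flow_path[OF \<phi> x] \<omega> this] show ?thesis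
    unfolding flow_integral_def by (simp add: continuous_intros)
qed

lemma flow_primitive_exists:
  assumes "continuous_flow X \<phi>" "closed_form X \<omega>" "x \<in> topspace X" "T \<ge> 0"
  obtains P where "primitive_along \<omega> (\<lambda>s. \<phi> (x, s)) {-T..T} P"
  using primitive_along_exists[OF continuous_flow_path[OF assms(1,3)] assms(2), of "\<lambda>x. x" "-T" T] assms(4)
  by auto

text \<open>A primitive along the trajectory of \<open>x\<close>, translated by \<open>s\<close>, is
  a primitive along the trajectory of \<open>\<phi> (x, s)\<close>; both sides are differences of
  the same function.\<close>

lemma flow_integral_cocycle:
  assumes \<phi>: "continuous_flow X \<phi>" and \<omega>: "closed_form X \<omega>" and x: "x \<in> topspace X"
  shows "flow_integral \<omega> \<phi> x (s + t) = flow_integral \<omega> \<phi> x s + flow_integral \<omega> \<phi> (\<phi> (x, s)) t"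
proof -
  obtain P where P: "primitive_along \<omega> (\<lambda>r. \<phi> (x, r)) {-(\<bar>s\<bar>+\<bar>t\<bar>)..\<bar>s\<bar>+\<bar>t\<bar>} P"
    using flow_primitive_exists[OF assms, of "\<bar>s\<bar>+\<bar>t\<bar>"] by auto
  have y: "\<phi> (x, s) \<in> topspace X"
    using \<phi> x by (auto simp: continuous_flow_def continuous_map_def Pi_iff)
  have "primitive_along \<omega> (\<lambda>r. \<phi> (\<phi> (x, s), r)) {-\<bar>t\<bar>..\<bar>t\<bar>} (\<lambda>r. P (s + r * 1))"
    by (rule primitive_along_scale[OF P]) (use \<phi> x in \<open>auto simp: continuous_flow_def\<close>)
  from flow_integral_primitive[OF \<phi> \<omega> y this, of t] show ?thesis
    using flow_integral_primitive[OF \<phi> \<omega> x P, of s] flow_integral_primitive[OF \<phi> \<omega> x P, of "s+t"]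
    by auto
qed

lemma flow_integral_local:
  assumes \<phi>: "continuous_flow X \<phi>" and \<omega>: "closed_form X \<omega>" and x: "x \<in> topspace X"
    and U: "(U, f) \<in> \<omega>" and t: "0 \<le> t" "\<And>r. r \<in> {0..t} \<Longrightarrow> \<phi> (x, r) \<in> U"
  shows "flow_integral \<omega> \<phi> x t = f (\<phi> (x, t)) - f x"
proof -
  obtain P where P: "primitive_along \<omega> (\<lambda>r. \<phi> (x, r)) {-t..t} P"
    using flow_primitive_exists[OF \<phi> \<omega> x, of t] t by auto
  have "primitive_along \<omega> (\<lambda>r. \<phi> (x, r)) {0..t} P"
    by (rule primitive_along_mono[OF P]) auto
  from primitive_along_local[OF this U, of 0 t] have "P t - P 0 = f (\<phi> (x, t)) - f (\<phi> (x, 0))"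
    using t by (auto simp: image_subset_iff)
  moreover have "\<phi> (x, 0) = x" using \<phi> x by (auto simp: continuous_flow_def)
  ultimately show ?thesis
    using flow_integral_primitive[OF \<phi> \<omega> x P, of t] t by auto
qed

lemma flow_integral_fixed:
  assumes \<phi>: "continuous_flow X \<phi>" and \<omega>: "closed_form X \<omega>" and x: "x \<in> flow_fix X \<phi>"
  shows "flow_integral \<omega> \<phi> x t = 0"
proof -
  have x': "x \<in> topspace X" "\<And>s. \<phi> (x, s) = x" using x by (auto simp: flow_fix_def)
  obtain U f where U: "(U, f) \<in> \<omega>" "x \<in> U"
    using closed_form_cover[OF \<omega> x'(1)] by blast
  have pos: "flow_integral \<omega> \<phi> x s = 0" if "s \<ge> 0" for s
    using flow_integral_local[OF \<phi> \<omega> x'(1) U(1) that] x' U by auto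
  show ?thesis
    using pos[of t] pos[of "-t"] pos[of 0] flow_integral_cocycle[OF \<phi> \<omega> x'(1), of t "-t"] x'
    by (cases "t \<ge> 0") auto
qed

text \<open>The Lyapunov condition speaks only of time intervals spent in one chart. Short intervals
  are of this kind, and the strict decreases are chained by bisection.\<close>

lemma flow_integral_neg:
  assumes gr: "gradient_like X \<omega> \<phi>" and \<omega>: "closed_form X \<omega>" and x: "x \<in> topspace X - flow_fix X \<phi>"
    and t: "0 < t"
  shows "flow_integral \<omega> \<phi> x t < 0"
proof -
  have \<phi>: "continuous_flow X \<phi>" using gr by (simp add: gradient_like_def)
  have path: "continuous_map euclideanreal X (\<lambda>r. \<phi> (x, r))"
    using continuous_flow_path[OF \<phi>, of x "\<lambda>r. r"] x by auto
  have X: "x \<in> topspace X" using x by auto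
  let ?A = "flow_integral \<omega> \<phi> x"
  \<comment> \<open>The premise \<open>0 < t\<close> belongs to the induction predicate, because
    \<open>Bolzano\<close> also passes through degenerate intervals, where no strict decrease is
    possible.\<close>
  have "0 < t \<longrightarrow> ?A t < ?A 0"
    using less_imp_le[OF t]
  proof (induction rule: Bolzano)
    case (trans a b c)
    then show ?case by (cases "a = b"; cases "b = c") auto
  next
    case (local r)
    have "\<phi> (x, r) \<in> topspace X"
      using path by (auto simp: continuous_map_def)
    then obtain U f where U: "(U, f) \<in> \<omega>" "\<phi> (x, r) \<in> U"
      using closed_form_cover[OF \<omega>] by blast
    have "open {s. \<phi> (x, s) \<in> U}"
      using openin_continuous_map_preimage[OF path closed_form_open[OF \<omega> U(1)]] by simp
    then obtain d where d: "d > 0" "ball r d \<subseteq> {s. \<phi> (x, s) \<in> U}"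
      using U(2) by (auto simp: open_contains_ball)
    have "?A b < ?A a" if ab: "a \<le> r" "r \<le> b" "b - a < d" "a < b" for a b
    proof -
      have in_U: "\<phi> (x, s) \<in> U" if "s \<in> {a..b}" for s
        using that ab d(2) by (auto simp: subset_iff dist_real_def)
      have comp: "\<phi> (\<phi> (x, a), s) = \<phi> (x, a + s)" for s
        using \<phi> X by (auto simp: continuous_flow_def)
      have "\<phi> (x, a) \<in> topspace X" using path by (auto simp: continuous_map_def)
      from flow_integral_local[OF \<phi> \<omega> this U(1), of "b - a"]
      have "flow_integral \<omega> \<phi> (\<phi> (x, a)) (b - a) = f (\<phi> (x, b)) - f (\<phi> (x, a))"
        using in_U ab by (auto simp: comp)
      moreover have "f (\<phi> (x, b)) < f (\<phi> (x, a))"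
        using gr U(1) x in_U ab(4) unfolding gradient_like_def by blast
      ultimately show ?thesis
        using flow_integral_cocycle[OF \<phi> \<omega> X, of a "b - a"] by simp
    qed
    with d show ?case by blast
  qed
  moreover have "?A 0 = 0"
    using flow_integral_cocycle[OF \<phi> \<omega> X, of 0 0] \<phi> X by (auto simp: continuous_flow_def)
  ultimately show ?thesis using t by auto
qed

section \<open>Flows with a decreasing cocycle\<close>

lemma openin_forall_compact_interval:
  fixes a b :: real
  assumes h: "continuous_map (prod_topology Z (top_of_set {a..b})) X h" and S: "openin X S"
  shows "openin Z {z \<in> topspace Z. \<forall>t\<in>{a..b}. h (z, t) \<in> S}"
proof -
  define C where "C = {w \<in> topspace (prod_topology Z (top_of_set {a..b})). h w \<in> topspace X - S}"
  have "closedin (prod_topology Z (top_of_set {a..b})) C"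
    unfolding C_def
    by (intro closedin_continuous_map_preimage[OF h] closedin_diff closedin_topspace S)
  moreover have "compact_space (top_of_set {a..b})"
    by (simp add: compact_space_subtopology)
  \<comment> \<open>The tube lemma: projection along a compact factor is closed, so the points
    having some bad time form a closed set.\<close>
  ultimately have "closedin Z (fst ` C)"
    using Abstract_Topological_Spaces.closed_map_fst[of "top_of_set {a..b}" Z] by (simp add: closed_map_def)
  have h_in: "h (z, t) \<in> topspace X" if "z \<in> topspace Z" "t \<in> {a..b}" for z t
    using h that by (auto simp: continuous_map_def Pi_iff)
  have "z \<in> fst ` C \<longleftrightarrow> (\<exists>t\<in>{a..b}. h (z, t) \<notin> S)" if z: "z \<in> topspace Z" for z
  proof
    assume "z \<in> fst ` C"
    then obtain w where "w \<in> C" "z = fst w" by (rule imageE)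
    then show "\<exists>t\<in>{a..b}. h (z, t) \<notin> S" by (cases w) (auto simp: C_def)
  next
    assume "\<exists>t\<in>{a..b}. h (z, t) \<notin> S"
    then obtain t where "t \<in> {a..b}" "h (z, t) \<notin> S" by blast
    then have "(z, t) \<in> C" using z h_in by (simp add: C_def)
    then show "z \<in> fst ` C" by (metis fst_conv imageI)
  qed
  then have "{z \<in> topspace Z. \<forall>t\<in>{a..b}. h (z, t) \<in> S} = topspace Z - fst ` C"
    by blast
  with \<open>closedin Z (fst ` C)\<close> show ?thesis
    by (simp only: openin_diff openin_topspace)
qed

text \<open>Since \<open>H z\<close> becomes and stays strictly negative after its first nonpositive
  value, the sign of \<open>H z a\<close> tells on which side of \<open>a \<ge> 0\<close> the
  crossing time lies. Both \<open>{z. \<tau> z < a}\<close> and \<open>{z. a < \<tau> z}\<close> are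
  thus open, which is continuity. Points that start at or below the level get the time 0.\<close>

lemma hitting_time:
  fixes H :: "'a \<Rightarrow> real \<Rightarrow> real"
  assumes H: "continuous_map (prod_topology Z euclideanreal) euclideanreal (\<lambda>(z, t). H z t)"
    and "\<forall>z\<in>topspace Z. \<forall>s t. 0 \<le> s \<longrightarrow> s < t \<longrightarrow> H z s \<le> 0 \<longrightarrow> H z t < 0"
    and "\<forall>z\<in>topspace Z. \<exists>s\<ge>0. H z s < 0"
  obtains \<tau> where "continuous_map Z euclideanreal \<tau>"
    "\<And>z. z \<in> topspace Z \<Longrightarrow> \<tau> z \<ge> 0"
    "\<And>z. z \<in> topspace Z \<Longrightarrow> H z 0 \<le> 0 \<Longrightarrow> \<tau> z = 0"
    "\<And>z. z \<in> topspace Z \<Longrightarrow> H z 0 \<ge> 0 \<Longrightarrow> H z (\<tau> z) = 0"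
proof -
  have dec: "\<And>z s t. \<lbrakk>z \<in> topspace Z; 0 \<le> s; s < t; H z s \<le> 0\<rbrakk> \<Longrightarrow> H z t < 0"
    and neg: "\<And>z. z \<in> topspace Z \<Longrightarrow> \<exists>s\<ge>0. H z s < 0"
    using assms(2,3) by blast+
  have Ht: "continuous_map Z euclideanreal (\<lambda>z. H z t)" for t
  proof -
    have "continuous_map Z (prod_topology Z euclideanreal) (\<lambda>z. (z, t))"
      by (intro continuous_map_pairedI) auto
    from continuous_map_compose[OF this H] show ?thesis by (simp add: o_def)
  qed
  have Hz: "continuous_on UNIV (H z)" if "z \<in> topspace Z" for z
  proof -
    have "continuous_map euclideanreal (prod_topology Z euclideanreal) (\<lambda>t. (z, t))"
      using that by (intro continuous_map_pairedI) auto
    from continuous_map_compose[OF this H] show ?thesis by (simp add: o_def)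
  qed
  have "\<exists>t\<ge>0. (H z 0 \<le> 0 \<longrightarrow> t = 0) \<and> (H z 0 \<ge> 0 \<longrightarrow> H z t = 0)" if z: "z \<in> topspace Z" for z
  proof (cases "H z 0 \<le> 0")
    case True
    then show ?thesis by (intro exI[of _ 0]) auto
  next
    case False
    obtain s where "s \<ge> 0" "H z s < 0" using neg[OF z] by blast
    then obtain t where "0 \<le> t" "H z t = 0"
      using IVT2'[of "H z" s 0 0] False continuous_on_subset[OF Hz[OF z]] by auto
    with False show ?thesis by (intro exI[of _ t]) auto
  qed
  then obtain \<tau> where \<tau>: "\<And>z. z \<in> topspace Z \<Longrightarrow> \<tau> z \<ge> 0"
    "\<And>z. z \<in> topspace Z \<Longrightarrow> H z 0 \<le> 0 \<Longrightarrow> \<tau> z = 0"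
    "\<And>z. z \<in> topspace Z \<Longrightarrow> H z 0 \<ge> 0 \<Longrightarrow> H z (\<tau> z) = 0"
    by metis
  have le: "H z (\<tau> z) \<le> 0" if "z \<in> topspace Z" for z
    using \<tau>[OF that] by (cases "H z 0 \<le> 0") auto
  have lower: "a < \<tau> z \<longleftrightarrow> a < 0 \<or> 0 < H z a" if z: "z \<in> topspace Z" for z a
  proof (cases "a < 0")
    case False
    show ?thesis
    proof
      assume "a < \<tau> z"
      then show "a < 0 \<or> 0 < H z a"
        using dec[OF z, of a "\<tau> z"] \<tau>[OF z] False by (cases "H z 0 \<le> 0") force+
    next
      assume "a < 0 \<or> 0 < H z a"
      then show "a < \<tau> z"
        using dec[OF z, of "\<tau> z" a] \<tau>(1)[OF z] le[OF z] False
        by (cases a "\<tau> z" rule: linorder_cases) auto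
    qed
  qed (use \<tau>(1)[OF z] in auto)
  have upper: "\<tau> z < a \<longleftrightarrow> 0 < a \<and> H z a < 0" if z: "z \<in> topspace Z" for z a
  proof
    assume "\<tau> z < a"
    then show "0 < a \<and> H z a < 0"
      using dec[OF z \<tau>(1)[OF z]] le[OF z] \<tau>(1)[OF z] by force
  next
    assume a: "0 < a \<and> H z a < 0"
    show "\<tau> z < a"
    proof (rule ccontr)
      assume "\<not> \<tau> z < a"
      then have "H z (\<tau> z) < 0"
        using a dec[OF z, of a "\<tau> z"] by (cases "\<tau> z = a") auto
      then show False
        using \<tau>(2,3)[OF z] a \<open>\<not> \<tau> z < a\<close> by (cases "H z 0 \<le> 0") auto
    qed
  qed
  have "openin Z {z \<in> topspace Z. \<tau> z < a}" for a
  proof -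
    have "{z \<in> topspace Z. \<tau> z < a} = (if 0 < a then {z \<in> topspace Z. H z a \<in> {..<0}} else {})"
      using upper by auto
    then show ?thesis
      using openin_continuous_map_preimage[OF Ht, of "{..<0}"] by auto
  qed
  moreover have "openin Z {z \<in> topspace Z. a < \<tau> z}" for a
  proof -
    have "{z \<in> topspace Z. a < \<tau> z} = (if a < 0 then topspace Z else {z \<in> topspace Z. H z a \<in> {0<..}})"
      using lower by auto
    then show ?thesis
      using openin_continuous_map_preimage[OF Ht, of "{0<..}"] by auto
  qed
  ultimately have "continuous_map Z euclideanreal \<tau>"
    by (simp add: continuous_map_upper_lower_semicontinuous_lt)
  with \<tau> that show thesis by blast
qed

lemma finite_Hausdorff_separation:
  assumes X: "Hausdorff_space X" and S: "finite S" "S \<subseteq> topspace X"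
  obtains D where "\<And>p. p \<in> S \<Longrightarrow> openin X (D p)" "\<And>p. p \<in> S \<Longrightarrow> p \<in> D p"
    "\<And>p q. \<lbrakk>p \<in> S; q \<in> S; p \<noteq> q\<rbrakk> \<Longrightarrow> disjnt (D p) (D q)"
proof -
  have "\<forall>p q. \<exists>U V. p \<in> S \<and> q \<in> S \<and> p \<noteq> q \<longrightarrow>
           openin X U \<and> openin X V \<and> p \<in> U \<and> q \<in> V \<and> disjnt U V"
    using X S unfolding Hausdorff_space_def by (meson subsetD)
  then obtain U V where UV: "\<And>p q. p \<in> S \<and> q \<in> S \<and> p \<noteq> q \<Longrightarrow>
           openin X (U p q) \<and> openin X (V p q) \<and> p \<in> U p q \<and> q \<in> V p q \<and> disjnt (U p q) (V p q)"
    by metis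
  \<comment> \<open>For \<open>q \<noteq> p\<close> this gives \<open>D p \<subseteq> U p q\<close>
    and \<open>D q \<subseteq> V p q\<close>, which are disjoint. Inserting
    \<open>topspace X\<close> covers the case in which \<open>p\<close> is the only point.\<close>
  define D where "D p = \<Inter>(insert (topspace X) ((\<lambda>q. U p q \<inter> V q p) ` (S - {p})))" for p
  show thesis
  proof
    fix p assume p: "p \<in> S"
    show "openin X (D p)"
      unfolding D_def by (rule openin_Inter) (use S p UV in auto)
    show "p \<in> D p"
      unfolding D_def using S p UV by auto
  next
    fix p q assume pq: "p \<in> S" "q \<in> S" "p \<noteq> q"
    then have "D p \<subseteq> U p q" "D q \<subseteq> V p q" by (auto simp: D_def)
    then show "disjnt (D p) (D q)"
      using UV[of p q] pq by (auto simp: disjnt_def)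
  qed
qed

lemma null_homotopic_in_deform:
  assumes g: "homotopic_with (\<lambda>_. True) (subtopology X G) X id g"
    and into: "\<And>x. x \<in> G \<Longrightarrow> g x \<in> V" and V: "null_homotopic_in X V"
  shows "null_homotopic_in X G"
proof -
  obtain c where "homotopic_with (\<lambda>_. True) (subtopology X V) X id (\<lambda>_. c)"
    using V unfolding null_homotopic_in_def by blast
  then have "homotopic_with (\<lambda>_. True) (subtopology X G) X (id \<circ> g) ((\<lambda>_. c) \<circ> g)"
  proof (rule homotopic_with_compose_continuous_map_right)
    have "continuous_map (subtopology X G) X g"
      using homotopic_with_imp_continuous_maps[OF g] by blast
    then show "continuous_map (subtopology X G) (subtopology X V) g"
      using into by (auto simp: continuous_map_in_subtopology)
  qed auto
  with g show ?thesis
    unfolding null_homotopic_in_def by (auto simp: o_def intro: homotopic_with_trans)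
qed

lemma null_homotopic_in_subset:
  assumes "null_homotopic_in X V" "G \<subseteq> V"
  shows "null_homotopic_in X G"
proof (rule null_homotopic_in_deform[OF _ _ assms(1)])
  show "homotopic_with (\<lambda>_. True) (subtopology X G) X id id"
    by (simp add: continuous_map_from_subtopology)
qed (use assms(2) in auto)

text \<open>Of the form only its cocycle is kept. These axioms survive time reversal
  (\<open>reversed\<close>), so statements about forward limits and first exits also yield those
  about backward limits and last entrances.\<close>

locale descending_flow =
  fixes X :: "'a topology" and \<phi> :: "'a \<times> real \<Rightarrow> 'a" and A :: "'a \<Rightarrow> real \<Rightarrow> real"
  assumes compact: "compact_space X" and Hausdorff: "Hausdorff_space X"
    and flow: "continuous_flow X \<phi>"
    and A_continuous: "continuous_map (prod_topology X euclideanreal) euclideanreal (\<lambda>(x, t). A x t)"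
    and A_add: "x \<in> topspace X \<Longrightarrow> A x (s + t) = A x s + A (\<phi> (x, s)) t"
    and A_fixed: "x \<in> flow_fix X \<phi> \<Longrightarrow> A x t = 0"
    and A_neg: "\<lbrakk>x \<in> topspace X - flow_fix X \<phi>; 0 < t\<rbrakk> \<Longrightarrow> A x t < 0"
    and finite_fix: "finite (flow_fix X \<phi>)"
begin

abbreviation Fix where "Fix \<equiv> flow_fix X \<phi>"

lemma flow_in [simp]: "x \<in> topspace X \<Longrightarrow> \<phi> (x, t) \<in> topspace X"
  using flow by (auto simp: continuous_flow_def continuous_map_def Pi_iff)

lemma flow_0 [simp]: "x \<in> topspace X \<Longrightarrow> \<phi> (x, 0) = x"
  and flow_add [simp]: "x \<in> topspace X \<Longrightarrow> \<phi> (\<phi> (x, s), t) = \<phi> (x, s + t)"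
  using flow by (auto simp: continuous_flow_def)

lemma Fix_subset: "Fix \<subseteq> topspace X"
  and Fix_flow: "x \<in> Fix \<Longrightarrow> \<phi> (x, t) = x"
  by (auto simp: flow_fix_def)

lemma flow_Fix_iff: "x \<in> topspace X \<Longrightarrow> \<phi> (x, t) \<in> Fix \<longleftrightarrow> x \<in> Fix"
  using Fix_flow[of "\<phi> (x, t)" "-t"] Fix_flow[of x t] by auto

lemma A_0 [simp]: "x \<in> topspace X \<Longrightarrow> A x 0 = 0"
  using A_add[of x 0 0] by simp

lemma A_nonpos: "\<lbrakk>x \<in> topspace X; 0 \<le> t\<rbrakk> \<Longrightarrow> A x t \<le> 0"
  using A_neg[of x t] A_fixed[of x t] by (cases "x \<in> Fix"; cases "t = 0") auto

lemma A_antimono: "\<lbrakk>x \<in> topspace X; s \<le> t\<rbrakk> \<Longrightarrow> A x t \<le> A x s"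
  using A_add[of x s "t - s"] A_nonpos[of "\<phi> (x, s)" "t - s"] by simp

lemma A_strict_antimono: "\<lbrakk>x \<in> topspace X - Fix; s < t\<rbrakk> \<Longrightarrow> A x t < A x s"
  using A_add[of x s "t - s"] A_neg[of "\<phi> (x, s)" "t - s"] flow_Fix_iff by simp

lemma continuous_map_flow:
  assumes "continuous_map Z X a" "continuous_map Z euclideanreal b"
  shows "continuous_map Z X (\<lambda>z. \<phi> (a z, b z))"
  using continuous_map_compose[OF continuous_map_pairedI[OF assms], of X \<phi>] flow
  by (simp add: continuous_flow_def o_def)

lemma continuous_map_A:
  assumes "continuous_map Z X a" "continuous_map Z euclideanreal b"
  shows "continuous_map Z euclideanreal (\<lambda>z. A (a z) (b z))"
  using continuous_map_compose[OF continuous_map_pairedI[OF assms] A_continuous]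
  by (simp add: o_def)

lemma openin_flow_preimage: "openin X S \<Longrightarrow> openin X {x \<in> topspace X. \<phi> (x, t) \<in> S}"
  by (rule openin_continuous_map_preimage[OF continuous_map_flow]) auto

lemma closedin_flow_preimage: "closedin X S \<Longrightarrow> closedin X {x \<in> topspace X. \<phi> (x, t) \<in> S}"
  by (rule closedin_continuous_map_preimage[OF continuous_map_flow]) auto

lemma open_flow_times: "\<lbrakk>x \<in> topspace X; openin X S\<rbrakk> \<Longrightarrow> open {t. \<phi> (x, t) \<in> S}"
  using openin_continuous_map_preimage[OF continuous_map_flow[of euclideanreal "\<lambda>_. x" "\<lambda>t. t"], of S]
  by simp

lemma closed_flow_times: "\<lbrakk>x \<in> topspace X; closedin X S\<rbrakk> \<Longrightarrow> closed {t. \<phi> (x, t) \<in> S}"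
  using closedin_continuous_map_preimage[OF continuous_map_flow[of euclideanreal "\<lambda>_. x" "\<lambda>t. t"], of S]
  by simp

lemma openin_flow_interval:
  assumes "openin X S"
  shows "openin X {x \<in> topspace X. \<forall>t\<in>{a..b}. \<phi> (x, t) \<in> S}"
proof (rule openin_forall_compact_interval[OF _ assms])
  have "continuous_map (prod_topology X (top_of_set {a..b})) X (\<lambda>z. \<phi> (fst z, snd z))"
    by (intro continuous_map_flow continuous_map_fst continuous_map_into_fulltopology[OF continuous_map_snd])
  then show "continuous_map (prod_topology X (top_of_set {a..b})) X \<phi>" by simp
qed

lemma openin_A: "open S \<Longrightarrow> openin X {x \<in> topspace X. A x t \<in> S}"
  by (rule openin_continuous_map_preimage[OF continuous_map_A]) auto

lemma reversed: "descending_flow X (\<lambda>(x, t). \<phi> (x, -t)) (\<lambda>x t. - A x (-t))"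
proof
  have fix_eq: "flow_fix X (\<lambda>(x, t). \<phi> (x, -t)) = Fix"
    unfolding flow_fix_def by (auto dest: spec[of _ "- _"])
  have "continuous_map (prod_topology X euclideanreal) X (\<lambda>z. \<phi> (fst z, - snd z))"
    by (intro continuous_map_flow continuous_map_fst continuous_map_minus continuous_map_snd)
  then show "continuous_flow X (\<lambda>(x, t). \<phi> (x, -t))"
    by (auto simp: continuous_flow_def case_prod_beta' add.commute)
  have "continuous_map (prod_topology X euclideanreal) euclideanreal (\<lambda>z. - A (fst z) (- snd z))"
    by (intro continuous_map_A continuous_map_fst continuous_map_minus continuous_map_snd)
  then show "continuous_map (prod_topology X euclideanreal) euclideanreal (\<lambda>(x, t). - A x (- t))"
    by (auto simp: case_prod_beta')
  show "- A x (- (s + t)) = - A x (- s) + - A (case (x, s) of (x, t) \<Rightarrow> \<phi> (x, - t)) (- t)"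
    if "x \<in> topspace X" for x s t
    using A_add[OF that, of "-s" "-t"] by simp
  show "- A x (- t) = 0" if "x \<in> flow_fix X (\<lambda>(x, t). \<phi> (x, - t))" for x t
    using that A_fixed unfolding fix_eq by simp
  show "- A x (- t) < 0" if "x \<in> topspace X - flow_fix X (\<lambda>(x, t). \<phi> (x, - t))" "0 < t" for x t
    using that A_strict_antimono[of x "-t" 0] unfolding fix_eq by simp
  show "finite (flow_fix X (\<lambda>(x, t). \<phi> (x, - t)))"
    unfolding fix_eq by (rule finite_fix)
qed (rule compact Hausdorff)+

lemma closedin_compactin: "closedin X K \<Longrightarrow> compactin X K"
  using closedin_compact_space[OF compact] .

section \<open>Cost of visits to compact sets, limits of trajectories, exits\<close>

lemma uniform_decrease:
  assumes "closedin X K" "K \<inter> Fix = {}"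
  obtains \<eta> where "\<eta> > 0" "\<And>y. y \<in> K \<Longrightarrow> A y 1 \<le> - \<eta>"
proof (cases "K = {}")
  case False
  have K: "K \<subseteq> topspace X" using assms(1) by (rule closedin_subset)
  have "compactin euclideanreal ((\<lambda>y. A y 1) ` K)"
    by (rule image_compactin[OF closedin_compactin[OF assms(1)] continuous_map_A]) auto
  then have "compact ((\<lambda>y. A y 1) ` K)" by simp
  then obtain y where "y \<in> K" "\<And>z. z \<in> K \<Longrightarrow> A z 1 \<le> A y 1"
    using compact_attains_sup[of "(\<lambda>y. A y 1) ` K"] False by auto
  moreover have "A y 1 < 0" using \<open>y \<in> K\<close> assms(2) K by (intro A_neg) auto
  ultimately show thesis using that[of "- A y 1"] by auto
qed (use that[of 1] in auto)

text \<open>Each visit to \<open>K\<close> lowers \<open>A x\<close> by at least \<eta> within the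
  next unit of time, whereas beyond the time \<open>T\<close> less than \<eta> remains above the
  infimum \<open>B\<close>.\<close>

lemma eventually_leaves:
  assumes x: "x \<in> topspace X" and bd: "\<And>t. 0 \<le> t \<Longrightarrow> - M \<le> A x t"
    and K: "closedin X K" "K \<inter> Fix = {}"
  obtains T where "\<And>t. t \<ge> T \<Longrightarrow> \<phi> (x, t) \<notin> K"
proof -
  obtain \<eta> where \<eta>: "\<eta> > 0" "\<And>y. y \<in> K \<Longrightarrow> A y 1 \<le> - \<eta>"
    using uniform_decrease[OF K] by blast
  define B where "B = Inf (A x ` {0..})"
  have bdd: "bdd_below (A x ` {0..})" using bd by (auto intro!: bdd_belowI[of _ "-M"])
  have "\<exists>v \<in> A x ` {0..}. v < B + \<eta>"
    using cInf_lessD[of "A x ` {0..}" "B + \<eta>"] \<eta>(1) by (force simp: B_def)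
  then obtain T where T: "T \<ge> 0" "A x T < B + \<eta>" by auto
  show thesis
  proof (rule that[of T], rule notI)
    fix t assume t: "t \<ge> T" "\<phi> (x, t) \<in> K"
    have "B \<le> A x (t + 1)"
      unfolding B_def using t T by (intro cInf_lower[OF _ bdd]) auto
    then show False
      using A_add[OF x, of t 1] \<eta>(2)[OF t(2)] A_antimono[OF x t(1)] T by linarith
  qed
qed

lemma bounded_descent_converges:
  assumes x: "x \<in> topspace X" and bd: "\<And>t. 0 \<le> t \<Longrightarrow> - M \<le> A x t"
  obtains p where "p \<in> Fix" "limitin X (\<lambda>t. \<phi> (x, t)) p at_top"
proof -
  obtain D where D: "\<And>p. p \<in> Fix \<Longrightarrow> openin X (D p)" "\<And>p. p \<in> Fix \<Longrightarrow> p \<in> D p"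
    "\<And>p q. \<lbrakk>p \<in> Fix; q \<in> Fix; p \<noteq> q\<rbrakk> \<Longrightarrow> disjnt (D p) (D q)"
    using finite_Hausdorff_separation[OF Hausdorff finite_fix Fix_subset] by metis
  \<comment> \<open>Connectedness of \<open>{T..}\<close> selects one of the disjoint
    neighbourhoods. The family \<open>D'\<close> is left free for two uses: \<open>D\<close> itself
    finds \<open>p\<close>, and shrinking it at \<open>p\<close> alone yields convergence, since a
    late time common to both forces the same fixed point.\<close>
  have ev: "\<exists>p\<in>Fix. \<exists>T. \<forall>t\<ge>T. \<phi> (x, t) \<in> D' p"
    if D': "\<And>p. p \<in> Fix \<Longrightarrow> openin X (D' p)" "\<And>p. p \<in> Fix \<Longrightarrow> p \<in> D' p"
      "\<And>p. p \<in> Fix \<Longrightarrow> D' p \<subseteq> D p" for D'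
  proof -
    let ?K = "topspace X - (\<Union>p\<in>Fix. D' p)"
    have "closedin X ?K" using D'(1) by blast
    moreover have "?K \<inter> Fix = {}" using D'(2) by auto
    ultimately obtain T where T: "\<And>t. t \<ge> T \<Longrightarrow> \<phi> (x, t) \<notin> ?K"
      using eventually_leaves[OF x bd] by metis
    then have cover: "\<exists>p\<in>Fix. \<phi> (x, t) \<in> D' p" if "t \<ge> T" for t
      using that x by fastforce
    then obtain p where p: "p \<in> Fix" "\<phi> (x, T) \<in> D' p" by blast
    let ?S = "{t. \<phi> (x, t) \<in> D' p}" and ?R = "{t. \<phi> (x, t) \<in> (\<Union>q\<in>Fix - {p}. D' q)}"
    have "open ?S" using open_flow_times[OF x] D'(1) p(1) by blast
    moreover have "open ?R" by (rule open_flow_times[OF x]) (use D'(1) in auto)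
    moreover have "{T..} \<subseteq> ?S \<union> ?R" using cover by auto
    moreover have "?S \<inter> ?R \<inter> {T..} = {}"
      using D(3) D'(3) p(1) by (fastforce simp: disjnt_iff)
    ultimately have "?S \<inter> {T..} = {} \<or> ?R \<inter> {T..} = {}"
      using connectedD[of "{T..}" ?S ?R] by auto
    then have "?R \<inter> {T..} = {}" using p(2) by auto
    then have "\<forall>t\<ge>T. \<phi> (x, t) \<in> D' p" using cover by fastforce
    with p show ?thesis by blast
  qed
  obtain p T where p: "p \<in> Fix" "\<And>t. t \<ge> T \<Longrightarrow> \<phi> (x, t) \<in> D p"
    using ev[of D] D by blast
  have "limitin X (\<lambda>t. \<phi> (x, t)) p at_top"
    unfolding limitin_def
  proof (intro conjI allI impI)
    show "p \<in> topspace X" using p(1) Fix_subset by blast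
  next
    fix U assume U: "openin X U \<and> p \<in> U"
    have "\<exists>q\<in>Fix. \<exists>T. \<forall>t\<ge>T. \<phi> (x, t) \<in> (if q = p then D p \<inter> U else D q)"
      by (rule ev) (use D U in auto)
    then obtain q T' where q: "q \<in> Fix" "\<And>t. t \<ge> T' \<Longrightarrow> \<phi> (x, t) \<in> (if q = p then D p \<inter> U else D q)"
      by blast
    have "\<phi> (x, max T T') \<in> D p" "\<phi> (x, max T T') \<in> D q"
      using p(2)[of "max T T'"] q(2)[of "max T T'"] by (auto split: if_splits)
    then have "q = p" using D(3)[OF p(1) q(1)] by (auto simp: disjnt_iff)
    then show "\<forall>\<^sub>F t in at_top. \<phi> (x, t) \<in> U"
      using q(2) by (auto simp: eventually_at_top_linorder)
  qed
  with p(1) that show thesis by blast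
qed

lemma bounded_ascent_converges:
  assumes x: "x \<in> topspace X" and bd: "\<And>t. 0 \<le> t \<Longrightarrow> A x (-t) \<le> M"
  obtains p where "p \<in> Fix" "limitin X (\<lambda>t. \<phi> (x, t)) p at_bot"
proof -
  have fix_eq: "flow_fix X (\<lambda>(x, t). \<phi> (x, -t)) = Fix"
    unfolding flow_fix_def by (auto dest: spec[of _ "- _"])
  obtain p where p: "p \<in> Fix" "limitin X (\<lambda>t. \<phi> (x, -t)) p at_top"
    using descending_flow.bounded_descent_converges[OF reversed x, of M] bd
    unfolding fix_eq by auto
  then have "limitin X (\<lambda>t. \<phi> (x, t)) p at_bot"
    unfolding limitin_def at_bot_mirror eventually_filtermap by simp
  with p that show thesis by blast
qed

text \<open>The times in \<open>{0..s}\<close> spent outside the open set \<open>W\<close> form a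
  compact set, and \<open>r\<close> is its least element. At time \<open>r\<close> the point is a
  limit of points of \<open>W\<close>, hence still in the closure.\<close>

lemma first_exit:
  assumes x: "x \<in> topspace X" "x \<in> W" and W: "openin X W" and s: "0 \<le> s" "\<phi> (x, s) \<notin> W"
  obtains r where "0 < r" "r \<le> s" "\<phi> (x, r) \<notin> W" "\<And>t. t \<in> {0..r} \<Longrightarrow> \<phi> (x, t) \<in> X closure_of W"
proof -
  have WC: "W \<subseteq> X closure_of W" by (intro closure_of_subset openin_subset W)
  let ?R = "{0..s} \<inter> {t. \<phi> (x, t) \<in> topspace X - W}"
  have "closedin X (topspace X - W)" using closedin_diff[OF closedin_topspace W] .
  then have "compact ?R"
    by (intro compact_Int_closed compact_Icc closed_flow_times[OF x(1)])
  moreover have "s \<in> ?R" using s x by auto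
  ultimately obtain r where r: "r \<in> ?R" "\<And>t. t \<in> ?R \<Longrightarrow> r \<le> t"
    using compact_attains_inf[of ?R] by blast
  have "r \<noteq> 0" using r(1) x by auto
  with r(1) have "0 < r" by auto
  have "\<phi> (x, t) \<in> W" if "t \<in> {0..<r}" for t
    using that r(1) r(2)[of t] x by fastforce
  then have "{0..<r} \<subseteq> {t. \<phi> (x, t) \<in> X closure_of W}" using WC by blast
  then have "closure {0..<r} \<subseteq> {t. \<phi> (x, t) \<in> X closure_of W}"
    by (rule closure_minimal) (rule closed_flow_times[OF x(1)], simp)
  then have "\<phi> (x, t) \<in> X closure_of W" if "t \<in> {0..r}" for t
    using that \<open>0 < r\<close> by auto
  with that \<open>0 < r\<close> r(1) show thesis by auto
qed

text \<open>The orbit segment of a non-fixed point is compact and misses \<open>q\<close>;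
  separating the two and using a tube around the segment makes the separation uniform near
  \<open>y\<close>.\<close>

lemma avoid_neighbourhood:
  assumes y: "y \<in> topspace X - Fix" and q: "q \<in> Fix"
  obtains D O' where "openin X D" "q \<in> D" "openin X O'" "y \<in> O'"
    "\<And>z t. \<lbrakk>z \<in> O'; t \<in> {0..T}\<rbrakk> \<Longrightarrow> \<phi> (z, t) \<notin> D"
proof -
  let ?G = "(\<lambda>t. \<phi> (y, t)) ` {0..T}"
  have "continuous_map euclideanreal X (\<lambda>t. \<phi> (y, t))"
    using y by (intro continuous_map_flow) auto
  then have G: "compactin X ?G"
    by (rule image_compactin[rotated]) auto
  have "q \<notin> ?G" using flow_Fix_iff[of y] y q by auto
  then have "disjnt ?G {q}" by auto
  then obtain U V where UV: "openin X U" "openin X V" "?G \<subseteq> U" "{q} \<subseteq> V" "disjnt U V"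
    using Hausdorff_space_compact_separation[OF Hausdorff G, of "{q}"] q Fix_subset
    by (metis compactin_sing subsetD)
  show thesis
    by (rule that[of V "{x \<in> topspace X. \<forall>t\<in>{0..T}. \<phi> (x, t) \<in> U}"])
       (use UV y openin_flow_interval[OF UV(1)] in \<open>auto simp: disjnt_iff\<close>)
qed

end

section \<open>Trajectories near the fixed points\<close>

text \<open>Pairs \<open>(p, p)\<close> are included, so acyclicity also rules out a single
  trajectory from \<open>p\<close> to itself, that is, a homoclinic cycle of length 1.\<close>

definition connections :: "'a topology \<Rightarrow> ('a \<times> real \<Rightarrow> 'a) \<Rightarrow> ('a \<times> 'a) set" where
  "connections X \<phi> = {(p, q). p \<in> flow_fix X \<phi> \<and> q \<in> flow_fix X \<phi> \<and>
     (\<exists>x \<in> topspace X - flow_fix X \<phi>.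
        limitin X (\<lambda>t. \<phi> (x, t)) p at_bot \<and> limitin X (\<lambda>t. \<phi> (x, t)) q at_top)}"

text \<open>\<open>U p\<close> and \<open>f p\<close> form a chart at \<open>p\<close>, and
  \<open>f_primitive\<close> is all that is remembered of the form. The closure of
  \<open>W p\<close> lies in the chart domain, so that \<open>f p\<close> is defined and bounded on
  this compact set.\<close>

locale isolated_fixed_points = descending_flow +
  fixes W :: "'a \<Rightarrow> 'a set" and U :: "'a \<Rightarrow> 'a set" and f :: "'a \<Rightarrow> 'a \<Rightarrow> real"
  assumes W_open: "p \<in> flow_fix X \<phi> \<Longrightarrow> openin X (W p)"
    and W_mem: "p \<in> flow_fix X \<phi> \<Longrightarrow> p \<in> W p"
    and W_disjoint: "\<lbrakk>p \<in> flow_fix X \<phi>; q \<in> flow_fix X \<phi>; p \<noteq> q\<rbrakk> \<Longrightarrow> disjnt (W p) (W q)"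
    and W_isolating: "p \<in> flow_fix X \<phi> \<Longrightarrow> X closure_of (W p) \<inter> flow_fix X \<phi> \<subseteq> {p}"
    and W_closure: "p \<in> flow_fix X \<phi> \<Longrightarrow> X closure_of (W p) \<subseteq> U p"
    and U_open: "p \<in> flow_fix X \<phi> \<Longrightarrow> openin X (U p)"
    and f_continuous: "p \<in> flow_fix X \<phi> \<Longrightarrow> continuous_map (subtopology X (U p)) euclideanreal (f p)"
    and f_primitive: "\<lbrakk>p \<in> flow_fix X \<phi>; x \<in> topspace X; 0 \<le> t; \<And>r. r \<in> {0..t} \<Longrightarrow> \<phi> (x, r) \<in> U p\<rbrakk>
       \<Longrightarrow> A x t = f p (\<phi> (x, t)) - f p x"
    and W_null_homotopic: "p \<in> flow_fix X \<phi> \<Longrightarrow> null_homotopic_in X (W p)"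
begin

lemma W_subset_closure: "p \<in> Fix \<Longrightarrow> W p \<subseteq> X closure_of W p"
  by (intro closure_of_subset openin_subset W_open)

text \<open>While the past stays in the closure of \<open>W p\<close>, the cocycle is a difference
  of two values of the bounded function \<open>f p\<close>. So the ascent is bounded, a backward
  limit exists, and \<open>p\<close> is the only fixed point available.\<close>

lemma backward_limit:
  assumes p: "p \<in> Fix" and y: "y \<in> topspace X" and C: "\<And>r. r \<le> 0 \<Longrightarrow> \<phi> (y, r) \<in> X closure_of W p"
  shows "limitin X (\<lambda>t. \<phi> (y, t)) p at_bot"
proof -
  let ?C = "X closure_of W p"
  have "compactin (subtopology X (U p)) ?C"
    using closedin_compactin[of ?C] W_closure[OF p] by (simp add: compactin_subtopology)
  then have "compact (f p ` ?C)"
    using image_compactin[OF _ f_continuous[OF p]] by fastforce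
  then obtain B where B: "\<And>z. z \<in> ?C \<Longrightarrow> \<bar>f p z\<bar> \<le> B"
    using compact_imp_bounded bounded_real by (metis imageI)
  have "A y (-t) \<le> 2 * B" if t: "0 \<le> t" for t
  proof -
    have "A (\<phi> (y, -t)) t = f p (\<phi> (\<phi> (y, -t), t)) - f p (\<phi> (y, -t))"
    proof (rule f_primitive[OF p _ t])
      fix r assume "r \<in> {0..t}"
      then show "\<phi> (\<phi> (y, -t), r) \<in> U p"
        using y C[of "-t + r"] W_closure[OF p] by auto
    qed (use y in auto)
    moreover have "A y (-t + t) = A y (-t) + A (\<phi> (y, -t)) t"
      by (rule A_add[OF y])
    ultimately show ?thesis
      using B[OF C[of 0]] B[OF C[of "-t"]] t y by simp
  qed
  then obtain q where q: "q \<in> Fix" "limitin X (\<lambda>t. \<phi> (y, t)) q at_bot"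
    using bounded_ascent_converges[OF y] by metis
  have "q \<in> ?C"
    by (rule limitin_closedin[OF q(2)]) (use C in \<open>auto simp: eventually_at_bot_linorder\<close>)
  with q W_isolating[OF p] show ?thesis by auto
qed

text \<open>By \<open>backward_limit\<close> these points lie on trajectories issuing from
  \<open>p\<close>: they are places where the unstable set of \<open>p\<close> has left
  \<open>W p\<close> while still on its frontier. Asking for the closure rather than for
  \<open>W p\<close> makes the set closed, hence compact.\<close>

definition unstable_exits :: "'a \<Rightarrow> 'a set" where
  "unstable_exits p = {y \<in> topspace X - W p. \<forall>r\<le>0. \<phi> (y, r) \<in> X closure_of W p}"

lemma compactin_unstable_exits:
  assumes p: "p \<in> Fix"
  shows "compactin X (unstable_exits p)"
proof -
  have "unstable_exits p = (topspace X - W p) \<inter> (\<Inter>r\<in>{..0}. {y \<in> topspace X. \<phi> (y, r) \<in> X closure_of W p})"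
    unfolding unstable_exits_def by auto
  also have "closedin X \<dots>"
    by (intro closedin_Int closedin_diff closedin_topspace W_open[OF p] closedin_INT closedin_flow_preimage) auto
  finally show ?thesis by (rule closedin_compactin)
qed

text \<open>A frontier point of \<open>W p\<close> away from \<open>S\<close> is not an unstable
  exit, so its past leaves the closure, and by compactness it does so within a uniform time
  \<open>n\<close>. A trajectory that has stayed in \<open>W p\<close> longer than \<open>n\<close>
  can therefore leave only through \<open>S\<close>.\<close>

lemma exits_near_unstable:
  assumes p: "p \<in> Fix" and S: "openin X S" "unstable_exits p \<subseteq> S"
  obtains V where "openin X V" "p \<in> V"
    "\<And>x s. \<lbrakk>x \<in> V; 0 \<le> s; \<phi> (x, s) \<notin> W p\<rbrakk> \<Longrightarrow> \<exists>r\<in>{0..s}. \<phi> (x, r) \<in> S"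
proof -
  let ?C = "X closure_of W p"
  define K where "K = topspace X - (W p \<union> S)"
  \<comment> \<open>\<open>R n\<close> collects the points whose past leaves the closure within time
    \<open>n\<close>; these open sets increase with \<open>n\<close> and cover
    \<open>K\<close>.\<close>
  define R where "R n = (\<Union>r\<in>{- real n..0}. {y \<in> topspace X. \<phi> (y, r) \<in> topspace X - ?C})" for n
  have "compactin X K"
    unfolding K_def by (intro closedin_compactin closedin_diff closedin_topspace openin_Un W_open p S)
  moreover have "openin X T" if "T \<in> range R" for T
  proof -
    have "openin X {y \<in> topspace X. \<phi> (y, r) \<in> topspace X - ?C}" for r
      by (intro openin_flow_preimage openin_diff) auto
    then have "openin X (R n)" for n
      unfolding R_def by (intro openin_Union) auto
    with that show ?thesis by auto
  qed
  moreover have "K \<subseteq> \<Union>(range R)"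
  proof
    fix y assume y: "y \<in> K"
    then obtain r where r: "r \<le> 0" "\<phi> (y, r) \<notin> ?C"
      using S(2) unfolding K_def unstable_exits_def by blast
    obtain n where "-r \<le> real n" using real_arch_simple by blast
    then have "y \<in> R n" using y r by (auto simp: R_def K_def)
    then show "y \<in> \<Union>(range R)" by blast
  qed
  ultimately obtain \<F> where F: "finite \<F>" "\<F> \<subseteq> range R" "K \<subseteq> \<Union>\<F>"
    using compactinD[of X K "range R"] by blast
  then obtain I where I: "finite I" "\<F> = R ` I"
    by (meson finite_subset_image)
  obtain n where n: "\<And>i. i \<in> I \<Longrightarrow> i \<le> n"
    using finite_nat_set_iff_bounded_le I(1) by meson
  have "R i \<subseteq> R n" if "i \<in> I" for i
    using n[OF that] unfolding R_def by fastforce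
  then have Kn: "K \<subseteq> R n" using F(3) I(2) by blast
  show thesis
  proof (rule that[of "{x \<in> topspace X. \<forall>t\<in>{0..real n}. \<phi> (x, t) \<in> W p}"])
    show "openin X {x \<in> topspace X. \<forall>t\<in>{0..real n}. \<phi> (x, t) \<in> W p}"
      by (rule openin_flow_interval[OF W_open[OF p]])
    show "p \<in> {x \<in> topspace X. \<forall>t\<in>{0..real n}. \<phi> (x, t) \<in> W p}"
      using p Fix_subset Fix_flow W_mem by auto
  next
    fix x s assume x: "x \<in> {x \<in> topspace X. \<forall>t\<in>{0..real n}. \<phi> (x, t) \<in> W p}"
      and s: "0 \<le> s" "\<phi> (x, s) \<notin> W p"
    then have xX: "x \<in> topspace X" and stay: "\<And>t. t \<in> {0..real n} \<Longrightarrow> \<phi> (x, t) \<in> W p" by auto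
    have "x \<in> W p" using stay[of 0] xX by simp
    then obtain r where r: "0 < r" "r \<le> s" "\<phi> (x, r) \<notin> W p" "\<And>t. t \<in> {0..r} \<Longrightarrow> \<phi> (x, t) \<in> ?C"
      using first_exit[OF xX _ W_open[OF p] s] by metis
    have "\<phi> (x, r) \<in> S"
    proof (rule ccontr)
      assume "\<phi> (x, r) \<notin> S"
      then have "\<phi> (x, r) \<in> R n" using Kn xX r(3) by (auto simp: K_def)
      then obtain u where u: "- real n \<le> u" "u \<le> 0" "\<phi> (x, r + u) \<notin> ?C"
        unfolding R_def using xX by auto
      then have "r + u < 0" using r(4)[of "r + u"] by force
      then show False using stay[of r] u r by auto
    qed
    with r show "\<exists>r\<in>{0..s}. \<phi> (x, r) \<in> S" by auto
  qed
qed

text \<open>If the trajectory of \<open>y\<close> descends below \<open>- M\<close> by a time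
  \<open>T\<close>, so do nearby ones, and they avoid \<open>q\<close> until then. Otherwise it
  converges to some \<open>p'\<close>, which is a successor of \<open>p\<close> and differs from
  \<open>q\<close>; nearby trajectories reach the neighbourhood of \<open>p'\<close> to which the
  hypothesis on successors applies.\<close>

lemma no_return_local:
  assumes p: "p \<in> Fix" and q: "q \<in> Fix" and y: "y \<in> unstable_exits p"
    and pq: "(p, q) \<notin> (connections X \<phi>)\<^sup>+"
    and IH: "\<And>p'. (p, p') \<in> connections X \<phi> \<Longrightarrow> \<exists>V D. openin X V \<and> p' \<in> V \<and> openin X D \<and> q \<in> D \<and>
          (\<forall>x\<in>V. \<forall>s t. 0 \<le> s \<longrightarrow> s \<le> t \<longrightarrow> \<phi> (x, s) \<notin> W p' \<longrightarrow> \<phi> (x, t) \<in> D \<longrightarrow> A x t < - M)"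
  shows "\<exists>O' D. openin X O' \<and> y \<in> O' \<and> openin X D \<and> q \<in> D \<and>
          (\<forall>z\<in>O'. \<forall>t\<ge>0. \<phi> (z, t) \<in> D \<longrightarrow> A z t < - M)"
proof -
  have yX: "y \<in> topspace X" and yW: "y \<notin> W p" and past: "\<And>r. r \<le> 0 \<Longrightarrow> \<phi> (y, r) \<in> X closure_of W p"
    using y by (auto simp: unstable_exits_def)
  have yF: "y \<notin> Fix"
    using past[of 0] yX yW W_isolating[OF p] W_mem[OF p] by auto
  show ?thesis
  proof (cases "\<exists>T\<ge>0. A y T < - M")
    case True
    then obtain T where T: "T \<ge> 0" "A y T < - M" by blast
    obtain D O' where DO: "openin X D" "q \<in> D" "openin X O'" "y \<in> O'"
      "\<And>z t. \<lbrakk>z \<in> O'; t \<in> {0..T}\<rbrakk> \<Longrightarrow> \<phi> (z, t) \<notin> D"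
      using avoid_neighbourhood[of y q T] yX yF q by blast
    let ?O = "O' \<inter> {z \<in> topspace X. A z T \<in> {..<-M}}"
    have "A z t < - M" if "z \<in> ?O" "t \<ge> 0" "\<phi> (z, t) \<in> D" for z t
    proof -
      have "T < t" using DO(5)[of z t] that by force
      then show ?thesis using A_antimono[of z T t] that by auto
    qed
    moreover have "openin X ?O" by (intro openin_Int DO openin_A) auto
    moreover have "y \<in> ?O" using DO T yX by auto
    ultimately show ?thesis using DO(1,2) by blast
  next
    case False
    then have bd: "\<And>t. 0 \<le> t \<Longrightarrow> - M \<le> A y t" by force
    obtain p' where p': "p' \<in> Fix" "limitin X (\<lambda>t. \<phi> (y, t)) p' at_top"
      using bounded_descent_converges[OF yX bd] by blast
    have pp': "(p, p') \<in> connections X \<phi>"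
      using backward_limit[OF p yX past] p p' yX yF by (auto simp: connections_def)
    then have "p' \<noteq> q" using pq by auto
    obtain V D where VD: "openin X V" "p' \<in> V" "openin X D" "q \<in> D"
      "\<And>x s t. \<lbrakk>x \<in> V; 0 \<le> s; s \<le> t; \<phi> (x, s) \<notin> W p'; \<phi> (x, t) \<in> D\<rbrakk> \<Longrightarrow> A x t < - M"
      using IH[OF pp'] by blast
    have "\<forall>\<^sub>F t in at_top. \<phi> (y, t) \<in> V"
      using p'(2) VD(1,2) unfolding limitin_def by blast
    then obtain T0 where T0: "\<And>t. t \<ge> T0 \<Longrightarrow> \<phi> (y, t) \<in> V"
      by (auto simp: eventually_at_top_linorder)
    define T where "T = max 0 T0"
    have T: "T \<ge> 0" "\<phi> (y, T) \<in> V" using T0 by (auto simp: T_def)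
    obtain D' O' where DO: "openin X D'" "q \<in> D'" "openin X O'" "y \<in> O'"
      "\<And>z t. \<lbrakk>z \<in> O'; t \<in> {0..T}\<rbrakk> \<Longrightarrow> \<phi> (z, t) \<notin> D'"
      using avoid_neighbourhood[of y q T] yX yF q by blast
    \<comment> \<open>Intersecting with \<open>W q\<close> puts the arrival point outside
      \<open>W p'\<close>, so the arrival itself is the departure from \<open>W p'\<close> required
      by \<open>IH\<close>, which is used with \<open>s = t\<close>.\<close>
    let ?O = "O' \<inter> {z \<in> topspace X. \<phi> (z, T) \<in> V}" and ?D = "D \<inter> D' \<inter> W q"
    have "A z t < - M" if z: "z \<in> ?O" and t: "t \<ge> 0" "\<phi> (z, t) \<in> ?D" for z t
    proof -
      have zX: "z \<in> topspace X" using z by auto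
      have "T < t" using DO(5)[of z t] z t by force
      have "\<phi> (\<phi> (z, T), t - T) = \<phi> (z, t)" using zX by simp
      moreover have "\<phi> (z, t) \<notin> W p'"
        using W_disjoint[OF p'(1) q \<open>p' \<noteq> q\<close>] t(2) by (auto simp: disjnt_iff)
      ultimately have "A (\<phi> (z, T)) (t - T) < - M"
        using VD(5)[of "\<phi> (z, T)" "t - T" "t - T"] z t \<open>T < t\<close> by auto
      then show ?thesis
        using A_add[OF zX, of T "t - T"] A_nonpos[OF zX T(1)] by simp
    qed
    moreover have "openin X ?O" by (intro openin_Int DO openin_flow_preimage VD)
    moreover have "y \<in> ?O" using DO T yX by auto
    moreover have "openin X ?D" by (intro openin_Int DO VD W_open q)
    moreover have "q \<in> ?D" using DO VD W_mem q by auto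
    ultimately show ?thesis by blast
  qed
qed

text \<open>Induction on \<open>p\<close> along the converse of \<open>connections\<close>,
  well-founded because the relation is finite and acyclic. The condition that \<open>q\<close> is
  not reachable passes to successors, and for \<open>p = q\<close> it is acyclicity. Finitely many
  neighbourhoods from \<open>no_return_local\<close> cover the compact set of unstable
  exits.\<close>

lemma no_return:
  assumes ac: "acyclic (connections X \<phi>)" and q: "q \<in> Fix" and p: "p \<in> Fix"
    and pq: "(p, q) \<notin> (connections X \<phi>)\<^sup>+"
  shows "\<exists>V D. openin X V \<and> p \<in> V \<and> openin X D \<and> q \<in> D \<and>
          (\<forall>x\<in>V. \<forall>s t. 0 \<le> s \<longrightarrow> s \<le> t \<longrightarrow> \<phi> (x, s) \<notin> W p \<longrightarrow> \<phi> (x, t) \<in> D \<longrightarrow> A x t < - M)"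
proof -
  have "connections X \<phi> \<subseteq> Fix \<times> Fix" by (auto simp: connections_def)
  then have "finite (connections X \<phi>)"
    using finite_fix finite_subset by blast
  then have "wf ((connections X \<phi>)\<inverse>)"
    using ac by (rule finite_acyclic_wf_converse)
  then show ?thesis
    using p pq
  proof (induction p rule: wf_induct_rule)
    case (less p)
    have near: "\<exists>O' D. openin X O' \<and> y \<in> O' \<and> openin X D \<and> q \<in> D \<and>
          (\<forall>z\<in>O'. \<forall>t\<ge>0. \<phi> (z, t) \<in> D \<longrightarrow> A z t < - M)" if "y \<in> unstable_exits p" for y
    proof (rule no_return_local[OF less.prems(1) q that less.prems(2)])
      fix p' assume pp': "(p, p') \<in> connections X \<phi>"
      then have "p' \<in> Fix" by (auto simp: connections_def)
      moreover have "(p', q) \<notin> (connections X \<phi>)\<^sup>+"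
        using less.prems(2) pp' by (meson trancl_into_trancl2)
      ultimately show "\<exists>V D. openin X V \<and> p' \<in> V \<and> openin X D \<and> q \<in> D \<and>
          (\<forall>x\<in>V. \<forall>s t. 0 \<le> s \<longrightarrow> s \<le> t \<longrightarrow> \<phi> (x, s) \<notin> W p' \<longrightarrow> \<phi> (x, t) \<in> D \<longrightarrow> A x t < - M)"
        using less.IH[of p'] pp' by blast
    qed
    then obtain O' D where OD: "\<And>y. y \<in> unstable_exits p \<Longrightarrow> openin X (O' y) \<and> y \<in> O' y \<and> openin X (D y) \<and> q \<in> D y"
      "\<And>y z t. \<lbrakk>y \<in> unstable_exits p; z \<in> O' y; t \<ge> 0; \<phi> (z, t) \<in> D y\<rbrakk> \<Longrightarrow> A z t < - M"
      by metis
    have "\<exists>\<F>. finite \<F> \<and> \<F> \<subseteq> O' ` unstable_exits p \<and> unstable_exits p \<subseteq> \<Union>\<F>"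
      by (rule compactinD[OF compactin_unstable_exits[OF less.prems(1)]]) (use OD(1) in auto)
    then obtain I where I: "finite I" "I \<subseteq> unstable_exits p" "unstable_exits p \<subseteq> \<Union>(O' ` I)"
      by (metis finite_subset_image)
    have S: "openin X (\<Union>(O' ` I))" using OD(1) I(2) by blast
    obtain V where V: "openin X V" "p \<in> V"
      "\<And>x s. \<lbrakk>x \<in> V; 0 \<le> s; \<phi> (x, s) \<notin> W p\<rbrakk> \<Longrightarrow> \<exists>r\<in>{0..s}. \<phi> (x, r) \<in> \<Union>(O' ` I)"
      using exits_near_unstable[OF less.prems(1) S I(3)] by metis
    \<comment> \<open>\<open>topspace X\<close> keeps the intersection open when \<open>I\<close> is
      empty, that is, when \<open>p\<close> has no unstable exits.\<close>
    define E where "E = \<Inter>(insert (topspace X) (D ` I))"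
    have "openin X E" unfolding E_def by (rule openin_Inter) (use I OD(1) in auto)
    moreover have "q \<in> E" using I OD(1) q Fix_subset by (auto simp: E_def)
    moreover have "A x t < - M"
      if x: "x \<in> V" and s: "0 \<le> s" "s \<le> t" "\<phi> (x, s) \<notin> W p" and t: "\<phi> (x, t) \<in> E" for x s t
    proof -
      have xX: "x \<in> topspace X" using x V(1) openin_subset by blast
      obtain r y where r: "0 \<le> r" "r \<le> s" "y \<in> I" "\<phi> (x, r) \<in> O' y"
        using V(3)[OF x s(1,3)] by auto
      have "\<phi> (\<phi> (x, r), t - r) \<in> D y" using t r xX by (auto simp: E_def)
      then have "A (\<phi> (x, r)) (t - r) < - M"
        using OD(2)[of y "\<phi> (x, r)" "t - r"] r I(2) s by auto
      then show ?thesis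
        using A_add[OF xX, of r "t - r"] A_nonpos[OF xX r(1)] by simp
    qed
    ultimately show ?case using V(1,2) by blast
  qed
qed

text \<open>Followed backwards, the trajectory first leaves \<open>W p\<close> at a point of the
  compact set \<open>?K\<close>, which contains no fixed point. Since \<open>?V\<close> requires the
  preceding unit of time to be spent in \<open>W p\<close>, more than one unit passes after that
  point, which costs at least \<eta>.\<close>

lemma entrance_descent:
  assumes p: "p \<in> Fix"
  obtains V \<eta> where "openin X V" "p \<in> V" "\<eta> > 0"
    "\<And>x t. \<lbrakk>x \<in> topspace X - W p; 0 \<le> t; \<phi> (x, t) \<in> V\<rbrakk> \<Longrightarrow> A x t \<le> - \<eta>"
proof -
  let ?K = "X closure_of W p - W p"
  have "closedin X ?K" by (intro closedin_diff W_open p) auto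
  moreover have "?K \<inter> Fix = {}" using W_isolating[OF p] W_mem[OF p] by auto
  ultimately obtain \<eta> where \<eta>: "\<eta> > 0" "\<And>y. y \<in> ?K \<Longrightarrow> A y 1 \<le> - \<eta>"
    using uniform_decrease by blast
  let ?V = "{z \<in> topspace X. \<forall>t\<in>{-1..0}. \<phi> (z, t) \<in> W p}"
  have "A x t \<le> - \<eta>" if x: "x \<in> topspace X - W p" and t: "0 \<le> t" "\<phi> (x, t) \<in> ?V" for x t
  proof -
    let ?z = "\<phi> (x, t)"
    have zX: "?z \<in> topspace X" and zW: "\<And>u. u \<in> {-1..0} \<Longrightarrow> \<phi> (x, t + u) \<in> W p" using x t by auto
    have "?z \<in> W p" using zW[of 0] by simp
    moreover have "(\<lambda>(x, t). \<phi> (x, -t)) (?z, t) \<notin> W p" using x by simp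
    ultimately obtain r where r: "0 < r" "r \<le> t" "\<phi> (?z, - r) \<notin> W p"
      "\<And>u. u \<in> {0..r} \<Longrightarrow> \<phi> (?z, - u) \<in> X closure_of W p"
      using descending_flow.first_exit[OF reversed zX _ W_open[OF p] t(1)] by auto
    let ?y = "\<phi> (x, t - r)"
    have y: "?y \<in> ?K" using r(3) r(4)[of r] r(1) x by auto
    have "1 < r" using zW[of "-r"] r x by fastforce
    have "A x t = A x (t - r) + A ?y r" using A_add[of x "t - r" r] x by simp
    moreover have "A x (t - r) \<le> 0" using A_nonpos x r by auto
    moreover have "A ?y r \<le> A ?y 1" using A_antimono x \<open>1 < r\<close> by auto
    ultimately show ?thesis using \<eta>(2)[OF y] by simp
  qed
  moreover have "openin X ?V" by (rule openin_flow_interval[OF W_open[OF p]])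
  moreover have "p \<in> ?V" using p Fix_subset Fix_flow W_mem by auto
  ultimately show thesis using that \<eta>(1) by blast
qed

end

section \<open>Deformations along the flow with continuous stopping times\<close>

context descending_flow
begin

lemma continuous_map_flow_push:
  assumes \<tau>: "continuous_map (subtopology X S) euclideanreal \<tau>"
  shows "continuous_map (prod_topology (top_of_set {0..1}) (subtopology X S)) X (\<lambda>(r, x). \<phi> (x, r * \<tau> x))"
proof -
  let ?Z = "prod_topology (top_of_set {0..1::real}) (subtopology X S)"
  have "continuous_map ?Z X snd"
    by (rule continuous_map_into_fulltopology[OF continuous_map_snd])
  moreover have "continuous_map ?Z euclideanreal fst"
    by (rule continuous_map_into_fulltopology[OF continuous_map_fst])
  moreover have "continuous_map ?Z euclideanreal (\<lambda>z. \<tau> (snd z))"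
    using continuous_map_compose[OF continuous_map_snd \<tau>] by (simp add: o_def)
  ultimately have "continuous_map ?Z X (\<lambda>z. \<phi> (snd z, fst z * \<tau> (snd z)))"
    by (intro continuous_map_flow continuous_map_real_mult)
  then show ?thesis by (simp add: case_prod_beta')
qed

lemma descent_time:
  obtains \<tau> where
    "openin X {x \<in> topspace X. \<exists>t\<ge>0. A x t < - N}"
    "continuous_map (subtopology X {x \<in> topspace X. \<exists>t\<ge>0. A x t < - N}) euclideanreal \<tau>"
    "\<And>x. \<lbrakk>x \<in> topspace X; \<exists>t\<ge>0. A x t < - N\<rbrakk> \<Longrightarrow> A x (\<tau> x) \<le> - N"
proof -
  let ?F = "{x \<in> topspace X. \<exists>t\<ge>0. A x t < - N}"
  let ?Z = "subtopology X ?F"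
  have "?F = (\<Union>t\<in>{0..}. {x \<in> topspace X. A x t \<in> {..<- N}})" by auto
  also have "openin X \<dots>"
    by (intro openin_Union) (use openin_A[of "{..<- N}"] in auto)
  finally have open_F: "openin X ?F" .
  have "continuous_map (prod_topology ?Z euclideanreal) euclideanreal (\<lambda>z. A (fst z) (snd z) + N)"
    by (intro continuous_map_add continuous_map_A continuous_map_into_fulltopology[OF continuous_map_fst]
        continuous_map_snd) auto
  then have H: "continuous_map (prod_topology ?Z euclideanreal) euclideanreal (\<lambda>(x, t). A x t + N)"
    by (simp add: case_prod_beta')
  have dec: "\<forall>x\<in>topspace ?Z. \<forall>s t. 0 \<le> s \<longrightarrow> s < t \<longrightarrow> A x s + N \<le> 0 \<longrightarrow> A x t + N < 0"
  proof (intro ballI allI impI)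
    fix x and s t :: real assume x: "x \<in> topspace ?Z" and st: "0 \<le> s" "s < t" "A x s + N \<le> 0"
    show "A x t + N < 0"
    proof (cases "x \<in> Fix")
      \<comment> \<open>A fixed point has cocycle 0, so it belongs to \<open>?F\<close> only if N is
        negative, and then the claim is immediate.\<close>
      case True
      then show ?thesis using A_fixed x by auto
    next
      case False
      then show ?thesis using A_strict_antimono[of x s t] x st by auto
    qed
  qed
  have neg: "\<forall>x\<in>topspace ?Z. \<exists>s\<ge>0. A x s + N < 0"
  proof
    fix x assume x: "x \<in> topspace ?Z"
    obtain s where "s \<ge> 0" "A x s < - N" using x by auto
    then show "\<exists>s\<ge>0. A x s + N < 0" by (intro exI[of _ s]) auto
  qed
  obtain \<tau> where \<tau>: "continuous_map ?Z euclideanreal \<tau>"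
    "\<And>x. x \<in> topspace ?Z \<Longrightarrow> \<tau> x \<ge> 0"
    "\<And>x. x \<in> topspace ?Z \<Longrightarrow> A x 0 + N \<le> 0 \<Longrightarrow> \<tau> x = 0"
    "\<And>x. x \<in> topspace ?Z \<Longrightarrow> A x 0 + N \<ge> 0 \<Longrightarrow> A x (\<tau> x) + N = 0"
    by (rule hitting_time[where H = "\<lambda>x t. A x t + N", OF H dec neg]) (rule that; blast)
  have "A x (\<tau> x) \<le> - N" if "x \<in> topspace X" "\<exists>t\<ge>0. A x t < - N" for x
    using that \<tau>(3)[of x] \<tau>(4)[of x] by (cases "A x 0 + N \<le> 0") auto
  with open_F \<tau>(1) that show thesis by blast
qed

lemma null_homotopic_push:
  assumes \<tau>: "continuous_map (subtopology X G) euclideanreal \<tau>" and G: "G \<subseteq> topspace X"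
    and into: "\<And>x. x \<in> G \<Longrightarrow> \<phi> (x, \<tau> x) \<in> V" and V: "null_homotopic_in X V"
  shows "null_homotopic_in X G"
proof (rule null_homotopic_in_deform[OF _ into V])
  show "homotopic_with (\<lambda>_. True) (subtopology X G) X id (\<lambda>x. \<phi> (x, \<tau> x))"
    by (subst homotopic_with, simp)
       (intro exI[of _ "\<lambda>(r, x). \<phi> (x, r * \<tau> x)"] conjI continuous_map_flow_push \<tau>; use G in force)
qed

end

context isolated_fixed_points
begin

text \<open>On \<open>G\<close> the difference \<open>f p - f p p\<close> is transported back along
  trajectories to a continuous function \<open>g\<close>. Flowing until \<open>g\<close> plus the
  cocycle falls to \<epsilon> brings every point of \<open>G\<close> into
  \<open>W p\<close>.\<close>

lemma basin_neighbourhood: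
  assumes ac: "acyclic (connections X \<phi>)" and p: "p \<in> Fix"
  obtains G where "openin X G" "null_homotopic_in X G"
    "\<And>x. \<lbrakk>x \<in> topspace X; limitin X (\<lambda>t. \<phi> (x, t)) p at_top; \<And>t. 0 \<le> t \<Longrightarrow> - N \<le> A x t\<rbrakk> \<Longrightarrow> x \<in> G"
proof -
  \<comment> \<open>The bound \<open>- N \<le> A x t\<close> is closed. The extra 1 turns it into
    the strict inequality in \<open>good\<close>, which is open in \<open>x\<close>.\<close>
  define M where "M = N + 1"
  have "(p, p) \<notin> (connections X \<phi>)\<^sup>+" using ac by (auto simp: acyclic_def)
  from no_return[OF ac p p this, of M]
  obtain V0 D where VD: "openin X V0" "p \<in> V0" "openin X D" "p \<in> D"
    "\<And>x s t. \<lbrakk>x \<in> V0; 0 \<le> s; s \<le> t; \<phi> (x, s) \<notin> W p; \<phi> (x, t) \<in> D\<rbrakk> \<Longrightarrow> A x t < - M"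
    by blast
  obtain V1 \<eta> where V1: "openin X V1" "p \<in> V1" "\<eta> > 0"
    "\<And>x t. \<lbrakk>x \<in> topspace X - W p; 0 \<le> t; \<phi> (x, t) \<in> V1\<rbrakk> \<Longrightarrow> A x t \<le> - \<eta>"
    using entrance_descent[OF p] by metis
  \<comment> \<open>At a good time \<open>H\<close> lies between \<open>- 2 * \<epsilon>\<close> and
    0, and entering \<open>V\<close> from outside \<open>W p\<close> costs \<eta>; the contradiction
    in \<open>into\<close> rests on \<open>2 * \<epsilon> < \<eta>\<close>.\<close>
  define \<epsilon> where "\<epsilon> = \<eta> / 4"
  have \<epsilon>: "\<epsilon> > 0" "2 * \<epsilon> < \<eta>" using V1(3) by (auto simp: \<epsilon>_def)
  have WU: "W p \<subseteq> U p" using W_subset_closure[OF p] W_closure[OF p] by blast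
  have UX: "U p \<subseteq> topspace X" by (rule openin_subset[OF U_open[OF p]])
  let ?B = "{f p p - \<epsilon><..<f p p + \<epsilon>}"
  \<comment> \<open>\<open>V0\<close> and \<open>D\<close> serve \<open>no_return\<close> as source
    and target, \<open>V1\<close> serves \<open>entrance_descent\<close>, and the last factor
    controls the value of \<open>f p\<close>.\<close>
  define V where "V = V0 \<inter> D \<inter> V1 \<inter> W p \<inter> {x \<in> U p. f p x \<in> ?B}"
  have "openin (subtopology X (U p)) {x \<in> topspace (subtopology X (U p)). f p x \<in> ?B}"
    by (rule openin_continuous_map_preimage[OF f_continuous[OF p]]) auto
  then have "openin X {x \<in> U p. f p x \<in> ?B}"
    using U_open[OF p] UX by (auto simp: openin_open_subtopology Int_absorb1)
  then have V: "openin X V"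
    unfolding V_def by (intro openin_Int VD V1 W_open p)
  have pV: "p \<in> V"
    using VD V1 W_mem[OF p] WU \<epsilon> by (auto simp: V_def)

  define good where "good x s \<longleftrightarrow> 0 \<le> s \<and> \<phi> (x, s) \<in> V \<and> - M < A x s" for x s
  define G where "G = {x \<in> topspace X. \<exists>s. good x s}"
  have open_good: "openin X {x \<in> topspace X. good x s}" for s
  proof (cases "0 \<le> s")
    case True
    then have "{x \<in> topspace X. good x s} = {x \<in> topspace X. \<phi> (x, s) \<in> V} \<inter> {x \<in> topspace X. A x s \<in> {- M<..}}"
      by (auto simp: good_def)
    also have "openin X \<dots>" by (intro openin_Int openin_flow_preimage V openin_A) auto
    finally show ?thesis .
  qed (simp add: good_def)
  have "G = (\<Union>s. {x \<in> topspace X. good x s})" by (auto simp: G_def)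
  also have "openin X \<dots>" using open_good by (intro openin_Union) auto
  finally have open_G: "openin X G" .
  have GX: "G \<subseteq> topspace X" by (auto simp: G_def)

  \<comment> \<open>Between two good times the trajectory cannot leave \<open>W p\<close>: by
    \<open>no_return\<close> its arrival in \<open>D\<close> would then cost more than
    \<open>M\<close>. The cocycle there is thus a difference of values of \<open>f p\<close>, and
    all good times give the same transported value.\<close>
  have stay: "f p (\<phi> (x, s')) - A x s' = f p (\<phi> (x, s)) - A x s"
    if x: "x \<in> topspace X" and s: "good x s" "good x s'" "s \<le> s'" for x s s'
  proof -
    let ?z = "\<phi> (x, s)"
    have eq: "A x s' = A x s + A ?z (s' - s)" using A_add[OF x, of s "s' - s"] by simp
    have "A x s \<le> 0" using A_nonpos[OF x] s(1) by (auto simp: good_def)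
    then have big: "- M < A ?z (s' - s)" using s(2) eq by (auto simp: good_def)
    have "A ?z (s' - s) = f p (\<phi> (?z, s' - s)) - f p ?z"
    proof (rule f_primitive[OF p])
      fix r assume r: "r \<in> {0..s' - s}"
      have "\<phi> (?z, r) \<in> W p"
      proof (rule ccontr)
        assume "\<phi> (?z, r) \<notin> W p"
        then show False
          using VD(5)[of ?z r "s' - s"] r s x big by (auto simp: good_def V_def)
      qed
      then show "\<phi> (?z, r) \<in> U p" using WU by blast
    qed (use x s(3) in auto)
    with eq x show ?thesis by simp
  qed
  define g where "g x = (let s = SOME s. good x s in f p (\<phi> (x, s)) - A x s - f p p)" for x
  have g_eq: "g x = f p (\<phi> (x, s)) - A x s - f p p" if x: "x \<in> topspace X" and s: "good x s" for x s
  proof -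
    let ?s = "SOME s. good x s"
    have "good x ?s" using s by (rule someI)
    then show ?thesis
      using stay[OF x, of s ?s] stay[OF x, of ?s s] s by (cases "s \<le> ?s") (auto simp: g_def Let_def)
  qed
  \<comment> \<open>For a fixed time \<open>s\<close> the formula for \<open>g\<close> is continuous
    on the open set of points for which \<open>s\<close> is good; these sets cover \<open>G\<close>,
    and \<open>stay\<close> gives agreement on overlaps.\<close>
  have g_cont: "continuous_map (subtopology X G) euclideanreal g"
  proof (rule pasting_lemma[where I = UNIV and T = "\<lambda>s. {x \<in> topspace X. good x s}"
        and f = "\<lambda>s x. f p (\<phi> (x, s)) - A x s - f p p"])
    fix s :: real
    let ?S = "{x \<in> topspace X. good x s}"
    have sub: "?S \<subseteq> G" by (auto simp: G_def)
    then show "openin (subtopology X G) ?S"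
      using open_good[of s] open_G by (simp add: openin_open_subtopology)
    have "continuous_map (subtopology X ?S) (subtopology X (U p)) (\<lambda>x. \<phi> (x, s))"
      unfolding continuous_map_in_subtopology
    proof
      show "continuous_map (subtopology X ?S) X (\<lambda>x. \<phi> (x, s))"
        by (intro continuous_map_flow continuous_map_from_subtopology) auto
      show "(\<lambda>x. \<phi> (x, s)) \<in> topspace (subtopology X ?S) \<rightarrow> U p"
        by (auto simp: good_def V_def)
    qed
    from continuous_map_compose[OF this f_continuous[OF p]]
    have "continuous_map (subtopology X ?S) euclideanreal (\<lambda>x. f p (\<phi> (x, s)))"
      by (simp add: o_def)
    moreover have "continuous_map (subtopology X ?S) euclideanreal (\<lambda>x. A x s)"
      by (intro continuous_map_A continuous_map_from_subtopology) auto
    ultimately have "continuous_map (subtopology X ?S) euclideanreal (\<lambda>x. f p (\<phi> (x, s)) - A x s - f p p)"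
      by (intro continuous_map_diff) auto
    then show "continuous_map (subtopology (subtopology X G) ?S) euclideanreal
        (\<lambda>x. f p (\<phi> (x, s)) - A x s - f p p)"
      using sub by (simp add: subtopology_subtopology Int_absorb1)
  next
    fix s s' x assume "x \<in> topspace (subtopology X G) \<inter> {x \<in> topspace X. good x s} \<inter> {x \<in> topspace X. good x s'}"
    then show "f p (\<phi> (x, s)) - A x s - f p p = f p (\<phi> (x, s')) - A x s' - f p p"
      using g_eq[of x s] g_eq[of x s'] by auto
  next
    fix x assume "x \<in> topspace (subtopology X G)"
    then show "\<exists>s. s \<in> UNIV \<and> x \<in> {x \<in> topspace X. good x s} \<and> g x = f p (\<phi> (x, s)) - A x s - f p p"
      using g_eq by (auto simp: G_def)
  qed

  let ?Z = "subtopology X G"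
  \<comment> \<open>At a good time \<open>t\<close> this is
    \<open>f p (\<phi> (x, t)) - f p p - \<epsilon>\<close>. The level \<epsilon> lies above every
    value that \<open>f p - f p p\<close> takes on \<open>V\<close>, so the crossing has happened by
    every good time.\<close>
  define H where "H x t = g x + A x t - \<epsilon>" for x t
  have "continuous_map (prod_topology ?Z euclideanreal) euclideanreal (\<lambda>z. g (fst z) + A (fst z) (snd z) - \<epsilon>)"
  proof (intro continuous_map_add continuous_map_diff continuous_map_A continuous_map_snd)
    show "continuous_map (prod_topology ?Z euclideanreal) euclideanreal (\<lambda>z. g (fst z))"
      using continuous_map_compose[OF continuous_map_fst g_cont] by (simp add: o_def)
    show "continuous_map (prod_topology ?Z euclideanreal) X fst"
      by (rule continuous_map_into_fulltopology[OF continuous_map_fst])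
  qed auto
  then have H_cont: "continuous_map (prod_topology ?Z euclideanreal) euclideanreal (\<lambda>(x, t). H x t)"
    by (simp add: case_prod_beta' H_def)
  have H_good: "H x s = f p (\<phi> (x, s)) - f p p - \<epsilon>" if "x \<in> topspace X" "good x s" for x s
    using g_eq[OF that] by (simp add: H_def)
  have neg_good: "- 2 * \<epsilon> < H x s" "H x s < 0" if "x \<in> topspace X" "good x s" for x s
    using H_good[OF that] that(2) by (auto simp: good_def V_def)
  have less: "H x t < 0" if x: "x \<in> topspace ?Z" and st: "0 \<le> s" "s < t" "H x s \<le> 0" for x s t
  proof (cases "x \<in> Fix")
    case True
    obtain r where "good x r" using x by (auto simp: G_def)
    then have "H x r < 0" using neg_good x by auto
    then show ?thesis using A_fixed[OF True] by (simp add: H_def)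
  next
    case False
    then show ?thesis using A_strict_antimono[of x s t] x st by (auto simp: H_def)
  qed
  have dec: "\<forall>x\<in>topspace ?Z. \<forall>s t. 0 \<le> s \<longrightarrow> s < t \<longrightarrow> H x s \<le> 0 \<longrightarrow> H x t < 0"
    using less by blast
  have neg: "\<forall>x\<in>topspace ?Z. \<exists>s\<ge>0. H x s < 0"
  proof
    fix x assume x: "x \<in> topspace ?Z"
    obtain s where "good x s" using x by (auto simp: G_def)
    then show "\<exists>s\<ge>0. H x s < 0" using neg_good(2)[of x s] x by (auto simp: good_def)
  qed
  obtain \<tau> where \<tau>: "continuous_map ?Z euclideanreal \<tau>"
    "\<And>x. x \<in> topspace ?Z \<Longrightarrow> \<tau> x \<ge> 0"
    "\<And>x. x \<in> topspace ?Z \<Longrightarrow> H x 0 \<le> 0 \<Longrightarrow> \<tau> x = 0"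
    "\<And>x. x \<in> topspace ?Z \<Longrightarrow> H x 0 \<ge> 0 \<Longrightarrow> H x (\<tau> x) = 0"
    by (rule hitting_time[OF H_cont dec neg]) (rule that; blast)
  \<comment> \<open>Were the stopping point outside \<open>W p\<close>, the later visit to
    \<open>V\<close> at a good time \<open>s\<close> would lower \<open>H\<close> by at least
    \<eta>. But \<open>H\<close> is already nonpositive at the stopping time and still above
    \<open>- 2 * \<epsilon>\<close> at \<open>s\<close>.\<close>
  have into: "\<phi> (x, \<tau> x) \<in> W p" if x: "x \<in> G" for x
  proof (rule ccontr)
    assume out: "\<phi> (x, \<tau> x) \<notin> W p"
    have xX: "x \<in> topspace X" and xZ: "x \<in> topspace ?Z" using x GX by auto
    obtain s where s: "good x s" using x by (auto simp: G_def)
    have s0: "0 \<le> s" using s by (simp add: good_def)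
    have le: "H x (\<tau> x) \<le> 0" using \<tau>(3,4)[OF xZ] by (cases "H x 0 \<le> 0") auto
    have "\<tau> x \<le> s"
    proof (rule ccontr)
      assume "\<not> \<tau> x \<le> s"
      then have "H x (\<tau> x) < 0" "\<tau> x \<noteq> 0"
        using less[OF xZ s0, of "\<tau> x"] neg_good(2)[OF xX s] s0 by auto
      then show False using \<tau>(3,4)[OF xZ] by (cases "H x 0 \<le> 0") auto
    qed
    have "A (\<phi> (x, \<tau> x)) (s - \<tau> x) \<le> - \<eta>"
      using V1(4)[of "\<phi> (x, \<tau> x)" "s - \<tau> x"] out xX \<open>\<tau> x \<le> s\<close> s by (auto simp: good_def V_def)
    moreover have "A x s = A x (\<tau> x) + A (\<phi> (x, \<tau> x)) (s - \<tau> x)"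
      using A_add[OF xX, of "\<tau> x" "s - \<tau> x"] by simp
    ultimately have "H x s - H x (\<tau> x) \<le> - \<eta>" by (simp add: H_def)
    then show False using le neg_good(1)[OF xX s] \<epsilon> by linarith
  qed
  have "null_homotopic_in X G"
    by (rule null_homotopic_push[OF \<tau>(1) GX into W_null_homotopic[OF p]])
  moreover have "x \<in> G"
    if x: "x \<in> topspace X" and lim: "limitin X (\<lambda>t. \<phi> (x, t)) p at_top"
      and bd: "\<And>t. 0 \<le> t \<Longrightarrow> - N \<le> A x t" for x
  proof -
    have "\<forall>\<^sub>F t in at_top. \<phi> (x, t) \<in> V" using lim V pV unfolding limitin_def by blast
    then obtain T where T: "\<And>t. t \<ge> T \<Longrightarrow> \<phi> (x, t) \<in> V" by (auto simp: eventually_at_top_linorder)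
    have "good x (max 0 T)"
      using T[of "max 0 T"] bd[of "max 0 T"] by (auto simp: good_def M_def)
    then show ?thesis using x by (auto simp: G_def)
  qed
  ultimately show thesis using that open_G by blast
qed

end

section \<open>Local contractibility of finite CW complexes\<close>

lemma unit_disc_iff: "x \<in> unit_disc n \<longleftrightarrow> (\<forall>i\<ge>n. x i = 0) \<and> (\<Sum>i<n. (x i)\<^sup>2) \<le> 1"
  and open_unit_disc_iff: "x \<in> open_unit_disc n \<longleftrightarrow> (\<forall>i\<ge>n. x i = 0) \<and> (\<Sum>i<n. (x i)\<^sup>2) < 1"
  by (auto simp: unit_disc_def open_unit_disc_def topspace_Euclidean_space)

lemma open_unit_disc_subset: "open_unit_disc n \<subseteq> unit_disc n"
  by (auto simp: unit_disc_iff open_unit_disc_iff)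

text \<open>The product topology on \<open>nat \<Rightarrow> real\<close> is the topology of that
  type, so the discs become accessible to \<open>compact\<close> and
  \<open>continuous_on\<close>.\<close>

lemma subtopology_Euclidean_space_disc:
  "subtopology (Euclidean_space n) (unit_disc n) = top_of_set (unit_disc n)"
  "subtopology (Euclidean_space n) (open_unit_disc n) = top_of_set (open_unit_disc n)"
proof -
  have "{x. \<forall>i\<ge>n. x i = 0} \<inter> unit_disc n = unit_disc n"
    "{x. \<forall>i\<ge>n. x i = 0} \<inter> open_unit_disc n = open_unit_disc n"
    by (auto simp: unit_disc_iff open_unit_disc_iff)
  then show "subtopology (Euclidean_space n) (unit_disc n) = top_of_set (unit_disc n)"
  "subtopology (Euclidean_space n) (open_unit_disc n) = top_of_set (open_unit_disc n)"
    unfolding Euclidean_space_def by (simp_all add: subtopology_subtopology euclidean_product_topology)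
qed

definition radius :: "nat \<Rightarrow> (nat \<Rightarrow> real) \<Rightarrow> real" where
  "radius n x = sqrt (\<Sum>i<n. (x i)\<^sup>2)"

lemma continuous_on_radius: "continuous_on S (radius n)"
  unfolding radius_def[abs_def]
  by (intro continuous_intros continuous_on_subset[OF continuous_on_product_coordinates]) auto

lemma radius_nonneg: "0 \<le> radius n x"
  by (simp add: radius_def sum_nonneg)

lemma radius_scale: "radius n (\<lambda>i. c * x i) = \<bar>c\<bar> * radius n x"
  by (simp add: radius_def power_mult_distrib real_sqrt_mult flip: sum_distrib_left)

lemma unit_disc_radius: "x \<in> unit_disc n \<longleftrightarrow> (\<forall>i\<ge>n. x i = 0) \<and> radius n x \<le> 1"
  and open_unit_disc_radius: "x \<in> open_unit_disc n \<longleftrightarrow> (\<forall>i\<ge>n. x i = 0) \<and> radius n x < 1"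
  by (simp_all add: unit_disc_iff open_unit_disc_iff radius_def)

lemma compact_unit_disc: "compact (unit_disc n)"
proof -
  let ?B = "PiE UNIV (\<lambda>i. if i < n then {-1..1::real} else {0})"
  have "compactin (powertop_real UNIV) ?B"
    by (subst compactin_PiE) auto
  then have "compact ?B" by (simp add: euclidean_product_topology)
  moreover have "closed {x. radius n x \<le> 1}"
    by (intro closed_Collect_le continuous_on_radius continuous_intros)
  moreover have "unit_disc n = ?B \<inter> {x. radius n x \<le> 1}"
  proof -
    have "x i \<in> {-1..1}" if "x \<in> unit_disc n" "i < n" for x i
    proof -
      have "(x i)\<^sup>2 \<le> (\<Sum>i<n. (x i)\<^sup>2)"
        using that by (intro member_le_sum) auto
      then have "(x i)\<^sup>2 \<le> 1" using that by (auto simp: unit_disc_iff)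
      then show ?thesis by (simp add: abs_square_le_1 abs_le_iff)
    qed
    then show ?thesis
      by (auto simp: unit_disc_radius PiE_iff extensional_def split: if_splits) (metis linorder_not_less)
  qed
  ultimately show ?thesis by (simp add: compact_Int_closed)
qed

lemma compactin_disc_image:
  assumes "continuous_map (top_of_set (unit_disc n)) X \<Phi>" "compact C" "C \<subseteq> unit_disc n"
  shows "compactin X (\<Phi> ` C)"
  by (rule image_compactin[OF _ assms(1)]) (use assms in \<open>simp add: compactin_subtopology\<close>)

text \<open>
  For \<open>v \<noteq> 0\<close>, a homotopy from \<open>v\<close> to its projection onto the unit sphere.
\<close>
definition radial_push :: "nat \<Rightarrow> real \<times> (nat \<Rightarrow> real) \<Rightarrow> nat \<Rightarrow> real" where
  "radial_push n = (\<lambda>(t, v). \<lambda>i. (1 - t + t / radius n v) * v i)"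

lemma radius_radial_push:
  assumes "t \<in> {0..1}" "radius n v > 0"
  shows "radius n (radial_push n (t, v)) = (1 - t) * radius n v + t"
proof -
  have "1 - t + t / radius n v \<ge> 0" using assms by simp
  moreover have "radius n (radial_push n (t, v)) = \<bar>1 - t + t / radius n v\<bar> * radius n v"
    using radius_scale by (simp add: radial_push_def)
  moreover have "(1 - t + t / radius n v) * radius n v = (1 - t) * radius n v + t"
    using assms(2) by (simp add: field_simps)
  ultimately show ?thesis by simp
qed

lemma radial_push_in_disc:
  assumes "t \<in> {0..1}" "radius n v > 0" "v \<in> unit_disc n"
  shows "radial_push n (t, v) \<in> unit_disc n"
proof -
  have "(1 - t) * radius n v \<le> (1 - t) * 1"
    using assms by (intro mult_left_mono) (auto simp: unit_disc_radius)
  then have "radius n (radial_push n (t, v)) \<le> 1"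
    using radius_radial_push[OF assms(1,2)] by simp
  then show ?thesis
    using assms(3) by (auto simp: unit_disc_radius radial_push_def)
qed

lemma radial_push_0: "radial_push n (0, v) = v"
  and radial_push_sphere: "radius n v = 1 \<Longrightarrow> radial_push n (t, v) = v"
  by (auto simp: radial_push_def)

lemma continuous_on_radial_push:
  assumes "\<And>t v. (t, v) \<in> S \<Longrightarrow> radius n v \<noteq> 0"
  shows "continuous_on S (radial_push n)"
proof (rule continuous_on_coordinatewise_then_product)
  fix i
  have r: "continuous_on S (\<lambda>w. radius n (snd w))"
    by (rule continuous_on_compose2[OF continuous_on_radius[of UNIV]]) (auto intro: continuous_intros)
  have c: "continuous_on S (\<lambda>w. snd w i)"
    by (rule continuous_on_compose2[where g = "\<lambda>v. v i" and t = UNIV and f = snd]) (auto intro: continuous_intros)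
  have "continuous_on S (\<lambda>w. (1 - fst w + fst w / radius n (snd w)) * snd w i)"
    by (intro continuous_intros r c) (use assms in auto)
  then show "continuous_on S (\<lambda>w. radial_push n w i)"
    by (simp add: radial_push_def case_prod_beta')
qed

text \<open>\<open>U\<close> is thickened by an open collar of the cell: points of radius above 1/2
  whose radial projection is sent into \<open>U\<close>. Pushing outwards deforms the result into
  \<open>U\<close>. Openness and continuity are checked on closed sets, which arise from images of
  compact sets in a Hausdorff space.\<close>

lemma null_homotopic_attach_cell:
  assumes X: "Hausdorff_space X" and Y: "closedin X Y"
    and \<Phi>: "continuous_map (top_of_set (unit_disc n)) X \<Phi>"
    and inj: "inj_on \<Phi> (open_unit_disc n)"
    and disj: "\<Phi> ` open_unit_disc n \<inter> Y = {}"
    and bdy: "\<Phi> ` (unit_disc n - open_unit_disc n) \<subseteq> Y"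
    and U: "openin (subtopology X Y) U" "null_homotopic_in X U"
  obtains U' where "openin (subtopology X (Y \<union> \<Phi> ` open_unit_disc n)) U'" "U \<subseteq> U'"
    "null_homotopic_in X U'"
proof -
  let ?D = "unit_disc n" and ?B = "open_unit_disc n" and ?R = "radius n" and ?I = "{0..1::real}"
  \<comment> \<open>A compact collar that excludes the centre, where the radial push is
    discontinuous.\<close>
  define D1 where "D1 = {v \<in> ?D. 1/2 \<le> ?R v}"
  have D1R: "0 < ?R v" if "v \<in> D1" for v using that by (auto simp: D1_def)
  have "closed {v. 1/2 \<le> ?R v}"
    by (intro closed_Collect_le continuous_on_radius continuous_intros)
  then have cD1: "compact D1"
    unfolding D1_def using compact_Int_closed[OF compact_unit_disc] by (simp add: Collect_conj_eq)
  obtain O' where O': "openin X O'" "U = O' \<inter> Y" using U(1) by (auto simp: openin_subtopology)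
  have YX: "Y \<subseteq> topspace X" using Y by (rule closedin_subset)
  have D_in: "\<Phi> v \<in> topspace X" if "v \<in> ?D" for v
    using \<Phi> that by (auto simp: continuous_map_def)
  have BD: "?B \<subseteq> ?D" by (rule open_unit_disc_subset)
  have sphere: "?R v = 1 \<and> \<Phi> v \<in> Y" if "v \<in> ?D" "v \<notin> ?B" for v
    using that bdy by (auto simp: unit_disc_radius open_unit_disc_radius)
  have notY: "\<Phi> v \<notin> Y" if "v \<in> ?B" for v using that disj by blast

  have push_cont: "continuous_map (top_of_set (?I \<times> D1)) X (\<lambda>w. \<Phi> (radial_push n w))"
  proof -
    have "continuous_map (top_of_set (?I \<times> D1)) (top_of_set ?D) (radial_push n)"
      unfolding continuous_map_in_subtopology
      using radial_push_in_disc D1R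
      by (auto simp: D1_def intro!: continuous_on_radial_push)
    from continuous_map_compose[OF this \<Phi>] show ?thesis by (simp add: o_def)
  qed
  have push1Y: "\<Phi> (radial_push n (1, v)) \<in> Y" if "v \<in> D1" for v
    using sphere[of "radial_push n (1, v)"] radial_push_in_disc[of 1 n v] radius_radial_push[of 1 n v] D1R[OF that] that
    by (auto simp: D1_def open_unit_disc_radius)

  define D' where "D' = {v \<in> ?D. 1/2 < ?R v \<and> \<Phi> (radial_push n (1, v)) \<in> U}"
  have D'D1: "D' \<subseteq> D1" by (auto simp: D'_def D1_def)
  define U' where "U' = U \<union> \<Phi> ` D'"
  have U'X: "U' \<subseteq> topspace X"
    using O' YX D_in by (auto simp: U'_def D'_def)
  have sphere_D': "v \<in> D'" if "v \<in> ?D" "v \<notin> ?B" "\<Phi> v \<in> U" for v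
    using sphere[OF that(1,2)] that by (auto simp: D'_def radial_push_sphere)
  have U'Y: "U' \<inter> Y = U"
  proof -
    have "\<Phi> v \<in> U" if "v \<in> D'" "\<Phi> v \<in> Y" for v
    proof -
      have "v \<notin> ?B" using notY that by blast
      then show ?thesis using sphere[of v] that by (auto simp: D'_def radial_push_sphere)
    qed
    then show ?thesis using O' by (auto simp: U'_def)
  qed
  have U'_cell: "\<exists>v\<in>D' \<inter> ?B. x = \<Phi> v" if x: "x \<in> U'" "x \<notin> Y" for x
  proof -
    obtain v where "v \<in> D'" "x = \<Phi> v" using x O' by (auto simp: U'_def)
    then show ?thesis using sphere[of v] x by (auto simp: D'_def)
  qed

  have open_U': "openin (subtopology X (Y \<union> \<Phi> ` ?B)) U'"
  proof -
    \<comment> \<open>\<open>C1 \<union> C2\<close> is the part of the disc outside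
      \<open>D'\<close>. Its image is compact, hence closed, and together with \<open>Y - O'\<close>
      it fills the complement of \<open>U'\<close>.\<close>
    define C1 where "C1 = {v \<in> ?D. ?R v \<le> 1/2}"
    define C2 where "C2 = {v \<in> D1. \<Phi> (radial_push n (1, v)) \<in> topspace X - O'}"
    have "closed {v. ?R v \<le> 1/2}"
      by (intro closed_Collect_le continuous_on_radius continuous_intros)
    then have "compact C1"
      unfolding C1_def using compact_Int_closed[OF compact_unit_disc] by (simp add: Collect_conj_eq)
    moreover have "compact C2"
    proof -
      have "continuous_map (top_of_set D1) (top_of_set (?I \<times> D1)) (\<lambda>v. (1, v))"
        unfolding continuous_map_in_subtopology by (auto intro!: continuous_intros)
      from continuous_map_compose[OF this push_cont]
      have "continuous_map (top_of_set D1) X (\<lambda>v. \<Phi> (radial_push n (1, v)))" by (simp add: o_def)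
      then have "closedin (top_of_set D1) {v \<in> topspace (top_of_set D1). \<Phi> (radial_push n (1, v)) \<in> topspace X - O'}"
        by (rule closedin_continuous_map_preimage) (intro closedin_diff closedin_topspace O'(1))
      then have "closedin (top_of_set D1) C2" by (simp add: C2_def)
      then show ?thesis using cD1 closedin_compact by blast
    qed
    ultimately have "compactin X (\<Phi> ` (C1 \<union> C2))"
      by (intro compactin_disc_image[OF \<Phi>]) (auto simp: C1_def C2_def D1_def)
    then have cl: "closedin X (\<Phi> ` (C1 \<union> C2))"
      by (rule compactin_imp_closedin[OF X])
    have part: "v \<in> D' \<or> v \<in> C1 \<union> C2" if "v \<in> ?D" for v
      using that push1Y[of v] YX O' by (auto simp: D'_def C1_def C2_def D1_def)
    have part': "v \<notin> D'" if "v \<in> C1 \<union> C2" for v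
      using that O' by (auto simp: D'_def C1_def C2_def D1_def)
    have C_D: "C1 \<union> C2 \<subseteq> ?D" by (auto simp: C1_def C2_def D1_def)
    have "U' \<inter> \<Phi> ` (C1 \<union> C2) = {}"
    proof (rule ccontr)
      assume "U' \<inter> \<Phi> ` (C1 \<union> C2) \<noteq> {}"
      then obtain v where v: "v \<in> C1 \<union> C2" "\<Phi> v \<in> U'" by blast
      then have vD: "v \<in> ?D" using C_D by blast
      show False
      proof (cases "v \<in> ?B")
        case True
        then obtain u where "u \<in> D'" "u \<in> ?B" "\<Phi> v = \<Phi> u"
          using U'_cell[OF v(2) notY[OF True]] by blast
        then have "u = v" using inj_onD[OF inj] True by metis
        then show False using part'[OF v(1)] \<open>u \<in> D'\<close> by simp
      next
        case False
        then show False
          using sphere[OF vD False] U'Y v sphere_D'[OF vD False] part'[OF v(1)] by blast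
      qed
    qed
    moreover have "closedin X (Y - O')" using closedin_diff[OF Y O'(1)] .
    moreover have "U' = (Y \<union> \<Phi> ` ?B) \<inter> (topspace X - (\<Phi> ` (C1 \<union> C2) \<union> (Y - O')))"
    proof -
      have "U' \<subseteq> Y \<union> \<Phi> ` ?B" using U'_cell by blast
      moreover have "U' \<inter> (Y - O') = {}" using U'Y O'(2) by blast
      moreover have "x \<in> U'" if x: "x \<in> Y \<union> \<Phi> ` ?B" "x \<notin> \<Phi> ` (C1 \<union> C2)" "x \<notin> Y - O'" for x
      proof (cases "x \<in> Y")
        case True
        then show ?thesis using x(3) O'(2) True by (simp add: U'_def)
      next
        case False
        then obtain v where "v \<in> ?B" "x = \<Phi> v" using x(1) by blast
        then show ?thesis using part[of v] BD x(2) by (auto simp: U'_def)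
      qed
      ultimately show ?thesis using U'X \<open>U' \<inter> \<Phi> ` (C1 \<union> C2) = {}\<close> by blast
    qed
    moreover have "openin X (topspace X - (\<Phi> ` (C1 \<union> C2) \<union> (Y - O')))"
      by (intro openin_diff openin_topspace closedin_Un cl closedin_diff[OF Y O'(1)])
    ultimately show ?thesis by (auto simp: openin_subtopology)
  qed

  define h where "h = (\<lambda>(t, x). if x \<in> Y then x else \<Phi> (radial_push n (t, inv_into ?B \<Phi> x)))"
  have h_Y: "h (t, x) = x" if "x \<in> Y" for t x using that by (simp add: h_def)
  have h_B: "h (t, \<Phi> v) = \<Phi> (radial_push n (t, v))" if "v \<in> ?B" for t v
    using notY[OF that] inv_into_f_f[OF inj that] by (simp add: h_def)
  have h_in: "h (t, x) \<in> topspace X" if tx: "t \<in> ?I" "x \<in> U'" for t x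
  proof (cases "x \<in> Y")
    case False
    then obtain v where v: "v \<in> D'" "v \<in> ?B" "x = \<Phi> v" using U'_cell tx(2) by blast
    moreover have "radial_push n (t, v) \<in> ?D"
      using v D'D1 D1R BD by (intro radial_push_in_disc tx(1)) auto
    ultimately show ?thesis using h_B D_in by simp
  qed (use h_Y YX in auto)
  have h_cont: "continuous_map (prod_topology (top_of_set ?I) (subtopology X U')) X h"
    unfolding continuous_map_closedin
  proof (intro conjI allI impI)
    show "h \<in> topspace (prod_topology (top_of_set ?I) (subtopology X U')) \<rightarrow> topspace X"
      using h_in by auto
  next
    fix C assume C: "closedin X C"
    let ?P = "prod_topology (top_of_set ?I) X"
    define K where "K = {w \<in> ?I \<times> D1. \<Phi> (radial_push n w) \<in> C}"
    \<comment> \<open>Over \<open>U'\<close> this is the preimage of \<open>C\<close> under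
      \<open>h\<close>, written as a closed set over \<open>Y\<close> and a compact image from the
      collar. The two agree over the rim because the push fixes the unit sphere.\<close>
    define T where "T = ?I \<times> (Y \<inter> C) \<union> (\<lambda>w. (fst w, \<Phi> (snd w))) ` K"
    have "closedin (top_of_set (?I \<times> D1)) K"
      using closedin_continuous_map_preimage[OF push_cont C] by (simp add: K_def)
    moreover have "compact_space (top_of_set (?I \<times> D1))"
      using compact_Times[OF compact_Icc cD1] by (simp add: compact_space_subtopology)
    ultimately have "compactin (top_of_set (?I \<times> D1)) K"
      using closedin_compact_space by blast
    moreover have "continuous_map (top_of_set (?I \<times> D1)) ?P (\<lambda>w. (fst w, \<Phi> (snd w)))"
    proof (rule continuous_map_pairedI)
      show "continuous_map (top_of_set (?I \<times> D1)) (top_of_set ?I) fst"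
        unfolding continuous_map_in_subtopology by (auto intro!: continuous_intros)
      have "continuous_map (top_of_set (?I \<times> D1)) (top_of_set ?D) snd"
        unfolding continuous_map_in_subtopology by (auto intro: continuous_on_snd continuous_on_id simp: D1_def)
      from continuous_map_compose[OF this \<Phi>]
      show "continuous_map (top_of_set (?I \<times> D1)) X (\<lambda>w. \<Phi> (snd w))" by (simp add: o_def)
    qed
    ultimately have "compactin ?P ((\<lambda>w. (fst w, \<Phi> (snd w))) ` K)"
      by (rule image_compactin)
    moreover have "Hausdorff_space ?P"
      using X by (simp add: Hausdorff_space_prod_topology Hausdorff_space_subtopology)
    ultimately have "closedin ?P ((\<lambda>w. (fst w, \<Phi> (snd w))) ` K)"
      using compactin_imp_closedin by blast
    moreover have "closedin ?P (?I \<times> (Y \<inter> C))"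
      using Y C by (simp add: closedin_prod_Times_iff closedin_Int)
    ultimately have "closedin ?P T" unfolding T_def by (rule closedin_Un[rotated])
    moreover have "h (t, x) \<in> C \<longleftrightarrow> (t, x) \<in> T" if t: "t \<in> ?I" and x: "x \<in> U'" for t x
    proof (cases "x \<in> Y")
      case True
      have "x \<in> C" if "(t, v) \<in> K" "x = \<Phi> v" for v
      proof -
        have "v \<in> ?D" "\<Phi> (radial_push n (t, v)) \<in> C" using that by (auto simp: K_def D1_def)
        moreover have "v \<notin> ?B" using notY True that by blast
        ultimately show ?thesis using sphere[of v] that by (simp add: radial_push_sphere)
      qed
      then show ?thesis using True t by (auto simp: T_def h_Y)
    next
      case False
      then obtain v where v: "v \<in> D'" "v \<in> ?B" "x = \<Phi> v" using U'_cell x by blast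
      have "(t, x) \<in> T \<longleftrightarrow> (t, v) \<in> K"
      proof
        assume "(t, x) \<in> T"
        then obtain u where u: "(t, u) \<in> K" "x = \<Phi> u" using False by (auto simp: T_def)
        then have "u \<in> ?B" using sphere[of u] False by (auto simp: K_def D1_def)
        then have "u = v" using inj_onD[OF inj] u v by metis
        with u show "(t, v) \<in> K" by simp
      next
        assume "(t, v) \<in> K"
        then show "(t, x) \<in> T" using v(3) by (force simp: T_def)
      qed
      also have "\<dots> \<longleftrightarrow> h (t, x) \<in> C"
        using v t D'D1 h_B by (auto simp: K_def)
      finally show ?thesis by simp
    qed
    then have "{w \<in> topspace (prod_topology (top_of_set ?I) (subtopology X U')). h w \<in> C} = T \<inter> (?I \<times> U')"
      using U'X by auto
    moreover have "prod_topology (top_of_set ?I) (subtopology X U') = subtopology ?P (?I \<times> U')"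
      by (simp add: prod_topology_subtopology subtopology_subtopology)
    ultimately show "closedin (prod_topology (top_of_set ?I) (subtopology X U'))
        {w \<in> topspace (prod_topology (top_of_set ?I) (subtopology X U')). h w \<in> C}"
      by (auto simp: closedin_subtopology)
  qed
  have "null_homotopic_in X U'"
  proof (rule null_homotopic_in_deform[OF _ _ U(2)])
    have "h (0, x) = x" if x: "x \<in> U'" for x
    proof (cases "x \<in> Y")
      case False
      then obtain v where "v \<in> ?B" "x = \<Phi> v" using U'_cell x by blast
      then show ?thesis using h_B by (simp add: radial_push_0)
    qed (rule h_Y)
    then show "homotopic_with (\<lambda>_. True) (subtopology X U') X id (\<lambda>x. h (1, x))"
      by (subst homotopic_with, simp) (intro exI[of _ h] conjI h_cont; simp)
  next
    fix x assume x: "x \<in> U'"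
    show "h (1, x) \<in> U"
    proof (cases "x \<in> Y")
      case True
      then show ?thesis using x U'Y h_Y by auto
    next
      case False
      then obtain v where "v \<in> D'" "v \<in> ?B" "x = \<Phi> v" using U'_cell x by blast
      then show ?thesis using h_B by (simp add: D'_def)
    qed
  qed
  with open_U' that show thesis by (auto simp: U'_def)
qed

text \<open>The embedding supplies continuous disc coordinates on the open cell; they are shrunk
  linearly to the centre and mapped back by the characteristic map.\<close>

lemma null_homotopic_open_cell:
  assumes \<Phi>: "continuous_map (top_of_set (unit_disc n)) X \<Phi>"
    and emb: "embedding_map (top_of_set (open_unit_disc n)) X \<Phi>"
  shows "null_homotopic_in X (\<Phi> ` open_unit_disc n)"
proof -
  let ?B = "open_unit_disc n" and ?I = "{0..1::real}"
  let ?C = "subtopology X (\<Phi> ` ?B)"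
  have "homeomorphic_map (top_of_set ?B) ?C \<Phi>"
    using emb by (simp add: embedding_map_def)
  then obtain \<psi> where \<psi>: "homeomorphic_maps (top_of_set ?B) ?C \<Phi> \<psi>"
    using homeomorphic_map_maps by blast
  have inv: "\<Phi> (\<psi> x) = x" "\<psi> x \<in> ?B" if "x \<in> \<Phi> ` ?B" for x
    using \<psi> that by (auto simp: homeomorphic_maps_def)
  have \<psi>_cont: "continuous_map ?C euclidean \<psi>"
    using \<psi> by (auto simp: homeomorphic_maps_def intro: continuous_map_into_fulltopology)
  define k where "k = (\<lambda>w. \<lambda>i. (1 - fst w) * \<psi> (snd w) i :: real)"
  have k_in: "k (t, x) \<in> unit_disc n" if "t \<in> ?I" "x \<in> \<Phi> ` ?B" for t x
  proof -
    have "\<psi> x \<in> ?B" using inv that by blast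
    moreover have "(1 - t) * radius n (\<psi> x) \<le> 1 * radius n (\<psi> x)"
      using that by (intro mult_right_mono radius_nonneg) auto
    ultimately show ?thesis
      using that by (auto simp: k_def unit_disc_radius open_unit_disc_radius radius_scale)
  qed
  have "continuous_map (prod_topology (top_of_set ?I) ?C) (powertop_real UNIV) k"
    unfolding continuous_map_componentwise_UNIV
  proof
    fix i
    have "continuous_map euclidean euclideanreal (\<lambda>v :: nat \<Rightarrow> real. v i)" by simp
    from continuous_map_compose[OF continuous_map_compose[OF continuous_map_snd \<psi>_cont] this]
    have "continuous_map (prod_topology (top_of_set ?I) ?C) euclideanreal (\<lambda>w. \<psi> (snd w) i)"
      by (simp add: o_def)
    then show "continuous_map (prod_topology (top_of_set ?I) ?C) euclideanreal (\<lambda>w. k w i)"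
      unfolding k_def
      by (intro continuous_map_real_mult continuous_map_diff
          continuous_map_into_fulltopology[OF continuous_map_fst]) auto
  qed
  then have "continuous_map (prod_topology (top_of_set ?I) ?C) (top_of_set (unit_disc n)) k"
    using k_in by (auto simp: continuous_map_in_subtopology euclidean_product_topology)
  from continuous_map_compose[OF this \<Phi>]
  have "continuous_map (prod_topology (top_of_set ?I) ?C) X (\<Phi> \<circ> k)" .
  then have "homotopic_with (\<lambda>_. True) ?C X id (\<lambda>_. \<Phi> (\<lambda>_. 0))"
    by (subst homotopic_with, simp) (intro exI[of _ "\<Phi> \<circ> k"] conjI; use inv in \<open>auto simp: k_def\<close>)
  then show ?thesis unfolding null_homotopic_in_def by blast
qed

section \<open>Extension of null-homotopic open sets over all cells\<close>

locale finite_cell_structure =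
  fixes X :: "'a topology" and m :: nat and d :: "nat \<Rightarrow> nat" and \<Phi> :: "nat \<Rightarrow> (nat \<Rightarrow> real) \<Rightarrow> 'a"
  assumes Hausdorff: "Hausdorff_space X"
    and char_map: "i < m \<Longrightarrow> continuous_map (top_of_set (unit_disc (d i))) X (\<Phi> i)"
    and embedding: "i < m \<Longrightarrow> embedding_map (top_of_set (open_unit_disc (d i))) X (\<Phi> i)"
    and disjoint: "\<lbrakk>i < m; j < m; i \<noteq> j\<rbrakk> \<Longrightarrow>
      disjnt (\<Phi> i ` open_unit_disc (d i)) (\<Phi> j ` open_unit_disc (d j))"
    and cells_cover: "topspace X = (\<Union>i<m. \<Phi> i ` open_unit_disc (d i))"
    and boundary: "i < m \<Longrightarrow> \<Phi> i ` (unit_disc (d i) - open_unit_disc (d i)) \<subseteq>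
      (\<Union>j\<in>{j. j < m \<and> d j < d i}. \<Phi> j ` open_unit_disc (d j))"
begin

definition cells :: "nat set \<Rightarrow> 'a set" where
  "cells J = (\<Union>i\<in>J. \<Phi> i ` open_unit_disc (d i))"

text \<open>Requiring all cells of smaller dimension, not just those met by a boundary, makes
  \<open>cells J\<close> a subcomplex and reduces its growth to choosing a missing cell of least
  dimension.\<close>

definition lower :: "nat set \<Rightarrow> bool" where
  "lower J \<longleftrightarrow> J \<subseteq> {..<m} \<and> (\<forall>i\<in>J. \<forall>j<m. d j < d i \<longrightarrow> j \<in> J)"

lemma compactin_cells:
  assumes J: "lower J"
  shows "compactin X (cells J)"
proof -
  have sub: "\<Phi> i ` unit_disc (d i) \<subseteq> cells J" if i: "i \<in> J" for i
  proof -
    have "i < m" using J i by (auto simp: lower_def)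
    then have "\<Phi> i ` (unit_disc (d i) - open_unit_disc (d i)) \<subseteq> cells J"
      using boundary[of i] J i unfolding lower_def cells_def by blast
    moreover have "\<Phi> i ` open_unit_disc (d i) \<subseteq> cells J" using i by (auto simp: cells_def)
    ultimately show ?thesis by blast
  qed
  have "cells J = (\<Union>i\<in>J. \<Phi> i ` unit_disc (d i))"
  proof
    show "cells J \<subseteq> (\<Union>i\<in>J. \<Phi> i ` unit_disc (d i))"
      unfolding cells_def by (intro UN_mono image_mono open_unit_disc_subset order_refl)
    show "(\<Union>i\<in>J. \<Phi> i ` unit_disc (d i)) \<subseteq> cells J"
      using sub by (rule UN_least)
  qed
  moreover have "finite J" using J finite_subset by (auto simp: lower_def)
  moreover have "compactin X (\<Phi> i ` unit_disc (d i))" if "i \<in> J" for i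
    using J that compactin_disc_image[OF char_map compact_unit_disc] by (auto simp: lower_def)
  ultimately show ?thesis by (auto intro: compactin_Union)
qed

lemma closedin_cells: "lower J \<Longrightarrow> closedin X (cells J)"
  using compactin_cells compactin_imp_closedin[OF Hausdorff] by blast

lemma compact_space: "compact_space X"
proof -
  have "lower {..<m}" by (auto simp: lower_def)
  moreover have "cells {..<m} = topspace X" using cells_cover by (simp add: cells_def)
  ultimately show ?thesis using compactin_cells by (metis compact_space_def)
qed

text \<open>Induction on the number of missing cells. A missing cell of least dimension has its
  boundary in \<open>cells J\<close>, so \<open>null_homotopic_attach_cell\<close> applies.\<close>

lemma null_homotopic_extend:
  assumes "lower J" "openin (subtopology X (cells J)) U" "null_homotopic_in X U" "p \<in> U"
  shows "\<exists>U. openin X U \<and> p \<in> U \<and> null_homotopic_in X U"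
  using assms
proof (induction "card ({..<m} - J)" arbitrary: J U)
  case 0
  then have "{..<m} \<subseteq> J" by auto
  then have "J = {..<m}" using 0 by (auto simp: lower_def)
  then have "cells J = topspace X" using cells_cover by (simp add: cells_def)
  then show ?case using 0 by auto
next
  case (Suc c)
  then have "{..<m} - J \<noteq> {}" by force
  then obtain i0 where "i0 \<in> {..<m} - J" by blast
  then obtain i where i: "i \<in> {..<m} - J" "\<And>j. j \<in> {..<m} - J \<Longrightarrow> d i \<le> d j"
    using ex_has_least_nat[of "\<lambda>i. i \<in> {..<m} - J" i0 d] by blast
  have "i < m" "i \<notin> J" using i by auto
  have Jm: "J \<subseteq> {..<m}" using Suc.prems by (simp add: lower_def)
  have below: "j \<in> J" if "j < m" "d j < d i" for j
    using i(2)[of j] that by fastforce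
  have disj: "\<Phi> i ` open_unit_disc (d i) \<inter> cells J = {}"
    using disjoint[OF \<open>i < m\<close>] \<open>i \<notin> J\<close> Jm unfolding cells_def disjnt_def by fastforce
  have bdy: "\<Phi> i ` (unit_disc (d i) - open_unit_disc (d i)) \<subseteq> cells J"
    using boundary[OF \<open>i < m\<close>] below unfolding cells_def by blast
  have inj: "inj_on (\<Phi> i) (open_unit_disc (d i))"
    using embedding[OF \<open>i < m\<close>] homeomorphic_imp_injective_map
    unfolding embedding_map_def by fastforce
  obtain U' where U': "openin (subtopology X (cells J \<union> \<Phi> i ` open_unit_disc (d i))) U'" "U \<subseteq> U'"
    "null_homotopic_in X U'"
    using null_homotopic_attach_cell[OF Hausdorff closedin_cells[OF Suc.prems(1)] char_map[OF \<open>i < m\<close>]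
        inj disj bdy Suc.prems(2,3)] by blast
  show ?case
  proof (rule Suc.hyps(1)[OF _ _ _ U'(3)])
    have "{..<m} - insert i J = ({..<m} - J) - {i}" by auto
    then show "c = card ({..<m} - insert i J)" using Suc.hyps(2) i(1) by simp
    show "lower (insert i J)" using Suc.prems(1) below \<open>i < m\<close> by (auto simp: lower_def)
    show "openin (subtopology X (cells (insert i J))) U'"
      using U'(1) by (simp add: cells_def Un_commute)
    show "p \<in> U'" using U'(2) Suc.prems(4) by blast
  qed
qed

text \<open>The open cell containing \<open>p\<close> is open in its union with all cells of smaller
  dimension, because the latter form a closed set; it is then extended over the other cells.\<close>

lemma null_homotopic_neighbourhood:
  assumes "p \<in> topspace X"
  shows "\<exists>U. openin X U \<and> p \<in> U \<and> null_homotopic_in X U"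
proof -
  obtain i where i: "i < m" "p \<in> \<Phi> i ` open_unit_disc (d i)" using assms cells_cover by auto
  let ?J = "{j. j < m \<and> d j < d i}" and ?e = "\<Phi> i ` open_unit_disc (d i)"
  have "lower ?J" by (auto simp: lower_def)
  then have cl: "closedin X (cells ?J)" by (rule closedin_cells)
  have "?e \<inter> cells ?J = {}"
    using disjoint[OF i(1)] unfolding cells_def disjnt_def by fastforce
  moreover have "?e \<subseteq> topspace X" using i(1) cells_cover by blast
  ultimately have "?e = (topspace X - cells ?J) \<inter> cells (insert i ?J)"
    by (auto simp: cells_def)
  moreover have "openin X (topspace X - cells ?J)" using openin_diff[OF openin_topspace cl] .
  ultimately have "openin (subtopology X (cells (insert i ?J))) ?e"
    unfolding openin_subtopology by blast
  moreover have "lower (insert i ?J)" using i(1) by (auto simp: lower_def)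
  ultimately show ?thesis
    using null_homotopic_extend null_homotopic_open_cell[OF char_map[OF i(1)] embedding[OF i(1)]] i(2)
    by blast
qed

end

lemma finite_CW_complex_cell_structure:
  fixes X :: "'a topology"
  assumes "finite_CW_complex X"
  obtains m d \<Phi> where "finite_cell_structure X m d \<Phi>"
  using assms unfolding finite_CW_complex_def subtopology_Euclidean_space_disc
proof (elim conjE exE)
  fix m :: nat and d :: "nat \<Rightarrow> nat" and \<Phi> :: "nat \<Rightarrow> (nat \<Rightarrow> real) \<Rightarrow> 'a"
  assume "Hausdorff_space X"
    "\<forall>i<m. continuous_map (top_of_set (unit_disc (d i))) X (\<Phi> i)"
    "\<forall>i<m. embedding_map (top_of_set (open_unit_disc (d i))) X (\<Phi> i)"
    "\<forall>i<m. \<forall>j<m. i \<noteq> j \<longrightarrow> disjnt (\<Phi> i ` open_unit_disc (d i)) (\<Phi> j ` open_unit_disc (d j))"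
    "topspace X = (\<Union>i<m. \<Phi> i ` open_unit_disc (d i))"
    "\<forall>i<m. \<Phi> i ` (unit_disc (d i) - open_unit_disc (d i)) \<subseteq>
       (\<Union>j\<in>{j. j < m \<and> d j < d i}. \<Phi> j ` open_unit_disc (d j))"
  then show thesis
    by (intro that[of m d \<Phi>] finite_cell_structure.intro) simp_all
qed

section \<open>The covering\<close>

text \<open>By the tube lemma, one subdivision with one choice of charts serves a whole
  neighbourhood \<open>S\<close> of \<open>z0\<close>. There the integral is a finite sum of
  continuous terms, and the local statements are pasted.\<close>

lemma flow_integral_continuous:
  assumes \<phi>: "continuous_flow X \<phi>" and \<omega>: "closed_form X \<omega>"
  shows "continuous_map (prod_topology X euclideanreal) euclideanreal (\<lambda>(x, t). flow_integral \<omega> \<phi> x t)"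
proof -
  let ?P = "prod_topology X euclideanreal" and ?A = "\<lambda>z. flow_integral \<omega> \<phi> (fst z) (snd z)"
  have \<phi>_comp: "continuous_map Z X (\<lambda>z. \<phi> (a z, b z))"
    if "continuous_map Z X a" "continuous_map Z euclideanreal b" for Z :: "'b topology" and a b
    using continuous_map_compose[OF continuous_map_pairedI[OF that], of X \<phi>] \<phi>
    by (simp add: continuous_flow_def o_def)
  have "\<exists>S. openin ?P S \<and> z0 \<in> S \<and> continuous_map (subtopology ?P S) euclideanreal ?A"
    if z0: "z0 \<in> topspace ?P" for z0
  proof -
    let ?I = "\<lambda>N i. {real i / real N..real (Suc i) / real N}"
    have path: "continuous_map euclideanreal X (\<lambda>r. \<phi> (fst z, r * snd z))" if "z \<in> topspace ?P" for z
      using that by (intro continuous_flow_path[OF \<phi>] continuous_intros) auto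
    obtain N U f where N: "N > 0" "\<And>i. i < N \<Longrightarrow> (U i, f i) \<in> \<omega>"
      "\<And>i. i < N \<Longrightarrow> (\<lambda>r. \<phi> (fst z0, r * snd z0)) ` ?I N i \<subseteq> U i"
      using subordinate_subdivision[OF path[OF z0] \<omega>] by metis
    define T where "T i = {z \<in> topspace ?P. \<forall>r\<in>?I N i. \<phi> (fst z, r * snd z) \<in> U i}" for i
    define S where "S = \<Inter>(insert (topspace ?P) (T ` {..<N}))"
    have "openin ?P (T i)" if "i < N" for i
    proof -
      let ?Z = "prod_topology ?P (top_of_set (?I N i))"
      have "continuous_map ?Z X (\<lambda>w. \<phi> (fst (fst w), snd w * snd (fst w)))"
      proof (intro \<phi>_comp continuous_map_real_mult)
        show "continuous_map ?Z X (\<lambda>w. fst (fst w))"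
          using continuous_map_compose[OF continuous_map_fst continuous_map_fst] by (simp add: o_def)
        show "continuous_map ?Z euclideanreal (\<lambda>w. snd (fst w))"
          using continuous_map_compose[OF continuous_map_fst continuous_map_snd] by (simp add: o_def)
        show "continuous_map ?Z euclideanreal snd"
          by (rule continuous_map_into_fulltopology[OF continuous_map_snd])
      qed
      from openin_forall_compact_interval[OF this closed_form_open[OF \<omega> N(2)[OF that]]]
      show ?thesis by (simp add: T_def)
    qed
    then have "openin ?P S"
      unfolding S_def by (intro openin_Inter) (auto simp del: topspace_prod_topology)
    moreover have "z0 \<in> S" using N(3) z0 by (auto simp: S_def T_def)
    moreover have "continuous_map (subtopology ?P S) euclideanreal ?A"
    proof -
      have term_cont: "continuous_map (subtopology ?P S) euclideanreal (\<lambda>z. f i (\<phi> (fst z, c * snd z)))"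
        if i: "i < N" and c: "c \<in> ?I N i" for i c
      proof -
        have "continuous_map (subtopology ?P S) X (\<lambda>z. \<phi> (fst z, c * snd z))"
          by (intro \<phi>_comp continuous_map_real_mult continuous_map_from_subtopology
              continuous_map_fst continuous_map_snd) auto
        then have "continuous_map (subtopology ?P S) (subtopology X (U i)) (\<lambda>z. \<phi> (fst z, c * snd z))"
          using i c by (auto simp: continuous_map_in_subtopology S_def T_def)
        from continuous_map_compose[OF this closed_form_continuous[OF \<omega> N(2)[OF i]]]
        show ?thesis by (simp add: o_def)
      qed
      let ?s = "\<lambda>z. \<Sum>i<N. f i (\<phi> (fst z, real (Suc i) / real N * snd z)) - f i (\<phi> (fst z, real i / real N * snd z))"
      have "continuous_map (subtopology ?P S) euclideanreal ?s"
        by (intro continuous_map_sum continuous_map_diff term_cont) (auto simp: divide_right_mono)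
      moreover have "?s z = ?A z" if z: "z \<in> topspace (subtopology ?P S)" for z
      proof -
        have zP: "z \<in> topspace ?P" and zT: "\<And>i. i < N \<Longrightarrow> z \<in> T i" using z by (auto simp: S_def)
        obtain p where p: "primitive_along \<omega> (\<lambda>r. \<phi> (fst z, r * snd z)) {0..1} p"
          using primitive_along_exists[OF path[OF zP] \<omega>, of 0 1] by auto
        have "?A z = p 1 - p 0"
          unfolding flow_integral_def by (rule form_integral_eq[OF path[OF zP] \<omega> p])
        moreover have "?s z = p (real N / real N) - p (real 0 / real N)"
        proof (rule primitive_along_sum)
          show "primitive_along \<omega> (\<lambda>r. \<phi> (fst z, r * snd z)) {real 0 / real N..real N / real N} p"
            using p N(1) by simp
          show "(\<lambda>r. \<phi> (fst z, r * snd z)) ` ?I N i \<subseteq> U i" if "i < N" for i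
            using zT[OF that] by (auto simp: T_def)
        qed (use N(2) in \<open>auto simp: divide_right_mono\<close>)
        ultimately show ?thesis using N(1) by simp
      qed
      ultimately show ?thesis by (rule continuous_map_eq)
    qed
    ultimately show ?thesis by blast
  qed
  then obtain S where S: "\<And>z. z \<in> topspace ?P \<Longrightarrow> openin ?P (S z) \<and> z \<in> S z \<and>
      continuous_map (subtopology ?P (S z)) euclideanreal ?A"
    by metis
  have "continuous_map ?P euclideanreal ?A"
    by (rule pasting_lemma[where I = "topspace ?P" and T = S and f = "\<lambda>_. ?A"]) (use S in auto)
  then show ?thesis by (simp add: case_prod_beta')
qed

lemma gradient_like_descending_flow:
  assumes "compact_space X" "Hausdorff_space X" "closed_form X \<omega>" "gradient_like X \<omega> \<phi>"
    "finite (flow_fix X \<phi>)"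
  shows "descending_flow X \<phi> (flow_integral \<omega> \<phi>)"
proof -
  have \<phi>: "continuous_flow X \<phi>" using assms(4) by (simp add: gradient_like_def)
  show ?thesis
    by unfold_locales
       (use assms \<phi> in \<open>simp_all add: flow_integral_continuous flow_integral_cocycle
          flow_integral_fixed flow_integral_neg\<close>)
qed

lemma gradient_like_isolated_fixed_points:
  assumes X: "compact_space X" "Hausdorff_space X" and \<omega>: "closed_form X \<omega>"
    and gr: "gradient_like X \<omega> \<phi>" and fin: "finite (flow_fix X \<phi>)"
    and loc: "\<And>p. p \<in> topspace X \<Longrightarrow> \<exists>Q. openin X Q \<and> p \<in> Q \<and> null_homotopic_in X Q"
  obtains W U f where "isolated_fixed_points X \<phi> (flow_integral \<omega> \<phi>) W U f"
proof -
  interpret descending_flow X \<phi> "flow_integral \<omega> \<phi>"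
    by (rule gradient_like_descending_flow[OF X \<omega> gr fin])
  obtain D where D: "\<And>p. p \<in> Fix \<Longrightarrow> openin X (D p)" "\<And>p. p \<in> Fix \<Longrightarrow> p \<in> D p"
    "\<And>p q. \<lbrakk>p \<in> Fix; q \<in> Fix; p \<noteq> q\<rbrakk> \<Longrightarrow> disjnt (D p) (D q)"
    using finite_Hausdorff_separation[OF Hausdorff finite_fix Fix_subset] by metis
  have reg: "neighbourhood_base_of (closedin X) X"
    using X compact_Hausdorff_imp_regular_space neighbourhood_base_of_closedin by blast
  have "\<exists>W U f. openin X W \<and> p \<in> W \<and> (U, f) \<in> \<omega> \<and> X closure_of W \<subseteq> U \<and> X closure_of W \<subseteq> D p \<and>
      null_homotopic_in X W" if p: "p \<in> Fix" for p
  proof -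
    have pX: "p \<in> topspace X" using p Fix_subset by blast
    obtain U f where U: "(U, f) \<in> \<omega>" "p \<in> U" using closed_form_cover[OF \<omega> pX] by metis
    obtain Q where Q: "openin X Q" "p \<in> Q" "null_homotopic_in X Q" using loc[OF pX] by metis
    have "openin X (U \<inter> Q \<inter> D p)" "p \<in> U \<inter> Q \<inter> D p"
      using closed_form_open[OF \<omega> U(1)] U Q D p by auto
    \<comment> \<open>Regularity inserts the closed set \<open>V\<close>, so the closure of
      \<open>W\<close> stays inside the chart, and inside \<open>D p\<close>, which contains no
      other fixed point.\<close>
    then obtain W V where W: "openin X W" "closedin X V" "p \<in> W" "W \<subseteq> V" "V \<subseteq> U \<inter> Q \<inter> D p"
      using reg unfolding neighbourhood_base_of by metis
    have "X closure_of W \<subseteq> V" by (rule closure_of_minimal[OF W(4,2)])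
    moreover have "null_homotopic_in X W" by (rule null_homotopic_in_subset[OF Q(3)]) (use W in auto)
    ultimately show ?thesis using W U by blast
  qed
  then obtain W U f where *: "\<And>p. p \<in> Fix \<Longrightarrow> openin X (W p) \<and> p \<in> W p \<and> (U p, f p) \<in> \<omega> \<and>
      X closure_of (W p) \<subseteq> U p \<and> X closure_of (W p) \<subseteq> D p \<and> null_homotopic_in X (W p)"
    by metis
  have "isolated_fixed_points X \<phi> (flow_integral \<omega> \<phi>) W U f"
  proof (intro isolated_fixed_points.intro isolated_fixed_points_axioms.intro)
    show "descending_flow X \<phi> (flow_integral \<omega> \<phi>)" by unfold_locales
  next
    fix p q assume pq: "p \<in> Fix" "q \<in> Fix" "p \<noteq> q"
    have "W r \<subseteq> D r" if "r \<in> Fix" for r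
      using closure_of_subset[OF openin_subset, of X "W r"] *[OF that] by blast
    then have "W p \<subseteq> D p" "W q \<subseteq> D q" using pq by auto
    then show "disjnt (W p) (W q)" using D(3)[OF pq] by (auto simp: disjnt_iff)
  next
    fix p assume p: "p \<in> Fix"
    show "X closure_of W p \<inter> Fix \<subseteq> {p}"
    proof
      fix q assume q: "q \<in> X closure_of W p \<inter> Fix"
      then have "q \<in> D p" "q \<in> D q" using *[OF p] D(2) by auto
      then show "q \<in> {p}" using D(3)[OF p, of q] q by (auto simp: disjnt_iff)
    qed
    show "openin X (U p)" "continuous_map (subtopology X (U p)) euclideanreal (f p)"
      using closed_form_open[OF \<omega>] closed_form_continuous[OF \<omega>] *[OF p] by blast+
    show "flow_integral \<omega> \<phi> x t = f p (\<phi> (x, t)) - f p x"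
      if "x \<in> topspace X" "0 \<le> t" "\<And>r. r \<in> {0..t} \<Longrightarrow> \<phi> (x, r) \<in> U p" for x t
      using *[OF p] that by (intro flow_integral_local[OF flow \<omega>]) auto
  qed (use * in blast)+
  with that show thesis by blast
qed

lemma acyclic_connections:
  assumes "\<nexists>n x p. homoclinic_cycle X \<phi> n x p"
  shows "acyclic (connections X \<phi>)"
proof (rule ccontr)
  assume "\<not> acyclic (connections X \<phi>)"
  then obtain q where "(q, q) \<in> (connections X \<phi>)\<^sup>+" by (auto simp: acyclic_def)
  then obtain n where n: "0 < n" "(q, q) \<in> connections X \<phi> ^^ n" by (auto simp: trancl_power)
  then obtain g where g: "g 0 = q" "g n = q" "\<And>i. i < n \<Longrightarrow> (g i, g (Suc i)) \<in> connections X \<phi>"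
    by (auto simp: relpow_fun_conv)
  then have "\<forall>i. \<exists>x. i < n \<longrightarrow> x \<in> topspace X - flow_fix X \<phi> \<and>
      limitin X (\<lambda>t. \<phi> (x, t)) (g i) at_bot \<and> limitin X (\<lambda>t. \<phi> (x, t)) (g (Suc i)) at_top"
    unfolding connections_def by blast
  then obtain x where x: "\<And>i. i < n \<Longrightarrow> x i \<in> topspace X - flow_fix X \<phi> \<and>
      limitin X (\<lambda>t. \<phi> (x i, t)) (g i) at_bot \<and> limitin X (\<lambda>t. \<phi> (x i, t)) (g (Suc i)) at_top"
    by metis
  \<comment> \<open>The chain \<open>g\<close> is indexed from 0, a homoclinic cycle from 1;
    \<open>g n = g 0\<close> closes it up.\<close>
  have "homoclinic_cycle X \<phi> n (\<lambda>i. x (i - 1)) (\<lambda>i. g (i - 1))"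
    unfolding homoclinic_cycle_def
  proof (intro conjI ballI)
    show "1 \<le> n" using n(1) by simp
  next
    fix i assume "i \<in> {1..n}"
    then have "i - 1 < n" by auto
    then show "x (i - 1) \<in> topspace X - flow_fix X \<phi>" using x by blast
  next
    fix i assume "i \<in> {1..<n}"
    then show "limitin X (\<lambda>t. \<phi> (x (i - 1), t)) (g (i + 1 - 1)) at_top"
      "limitin X (\<lambda>t. \<phi> (x (i + 1 - 1), t)) (g (i + 1 - 1)) at_bot"
      using x[of "i - 1"] x[of i] by auto
  next
    show "limitin X (\<lambda>t. \<phi> (x (n - 1), t)) (g (1 - 1)) at_top"
      "limitin X (\<lambda>t. \<phi> (x (1 - 1), t)) (g (1 - 1)) at_bot"
      using x[of "n - 1"] x[of 0] n(1) g by auto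
  qed
  with assms show False by blast
qed

text \<open>The path of \<open>x\<close> in the homotopy \<open>\<phi> (x, r * \<tau> x)\<close> has
  integral \<open>A x (\<tau> x)\<close> by the assumption on \<open>A\<close>, so the bound from
  \<open>descent_time\<close> is the one required.\<close>

lemma (in descending_flow) movable_below_descent:
  assumes "\<And>x t. A x t = form_integral \<omega> (\<lambda>r. \<phi> (x, r * t))"
  shows "openin X {x \<in> topspace X. \<exists>t\<ge>0. A x t < - N}"
    "movable_below X \<omega> N {x \<in> topspace X. \<exists>t\<ge>0. A x t < - N}"
proof -
  let ?F = "{x \<in> topspace X. \<exists>t\<ge>0. A x t < - N}"
  obtain \<tau> where \<tau>: "openin X ?F" "continuous_map (subtopology X ?F) euclideanreal \<tau>"
    "\<And>x. \<lbrakk>x \<in> topspace X; \<exists>t\<ge>0. A x t < - N\<rbrakk> \<Longrightarrow> A x (\<tau> x) \<le> - N"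
    by (rule descent_time[of N]) (rule that; blast)
  show "openin X ?F" by (rule \<tau>(1))
  show "movable_below X \<omega> N ?F"
    unfolding movable_below_def
    by (intro exI[of _ "\<lambda>(r, x). \<phi> (x, r * \<tau> x)"] conjI continuous_map_flow_push \<tau>(2))
       (use \<tau>(3) assms in auto)
qed

theorem theorem1:
  fixes X :: "'a topology"
    and \<omega> :: "'a form"
    and \<xi> :: "'a chain set \<Rightarrow> real"
    and \<phi> :: "'a \<times> real \<Rightarrow> 'a"
    and k :: nat
  assumes "finite_CW_complex X"
    and "closed_form X \<omega>"
    and "represents X \<omega> \<xi>"
    and "gradient_like X \<omega> \<phi>"
    and "finite (flow_fix X \<phi>)"
    and "card (flow_fix X \<phi>) = k"
    and "k > 0"
    and "k < cat_class X \<xi>"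
  shows "\<exists>n x p. homoclinic_cycle X \<phi> n x p"
proof (rule ccontr)
  assume "\<not> ?thesis"
  then have ac: "acyclic (connections X \<phi>)" by (rule acyclic_connections)
  obtain m d \<Phi> where "finite_cell_structure X m d \<Phi>"
    using finite_CW_complex_cell_structure[OF assms(1)] by metis
  then interpret CW: finite_cell_structure X m d \<Phi> .
  obtain W U f where "isolated_fixed_points X \<phi> (flow_integral \<omega> \<phi>) W U f"
    using gradient_like_isolated_fixed_points[OF CW.compact_space CW.Hausdorff assms(2,4,5)
        CW.null_homotopic_neighbourhood] by metis
  then interpret isolated_fixed_points X \<phi> "flow_integral \<omega> \<phi>" W U f .
  \<comment> \<open>An enumeration of the fixed points from 1 to \<open>k\<close>, to match the
    index set of the cover in \<open>cat_class\<close>.\<close>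
  obtain b where b: "bij_betw b {1..k} Fix"
    using ex_bij_betw_nat_finite_1[OF assms(5)] assms(6) by metis
  have "\<exists>F G. openin X F \<and> (\<forall>j\<in>{1..k}. openin X (G j)) \<and>
              topspace X = F \<union> (\<Union>j\<in>{1..k}. G j) \<and>
              (\<forall>j\<in>{1..k}. null_homotopic_in X (G j)) \<and>
              movable_below X \<omega> (real N) F" for N :: nat
  proof -
    let ?F = "{x \<in> topspace X. \<exists>t\<ge>0. flow_integral \<omega> \<phi> x t < - real N}"
    have "\<exists>G. openin X G \<and> null_homotopic_in X G \<and>
        (\<forall>x\<in>topspace X. limitin X (\<lambda>t. \<phi> (x, t)) p at_top \<longrightarrow>
           (\<forall>t\<ge>0. - real N \<le> flow_integral \<omega> \<phi> x t) \<longrightarrow> x \<in> G)" if "p \<in> Fix" for p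
      using basin_neighbourhood[OF ac that, of "real N"] by metis
    then obtain G where G: "\<And>p. p \<in> Fix \<Longrightarrow> openin X (G p) \<and> null_homotopic_in X (G p) \<and>
        (\<forall>x\<in>topspace X. limitin X (\<lambda>t. \<phi> (x, t)) p at_top \<longrightarrow>
           (\<forall>t\<ge>0. - real N \<le> flow_integral \<omega> \<phi> x t) \<longrightarrow> x \<in> G p)"
      by metis
    have bF: "b j \<in> Fix" if "j \<in> {1..k}" for j
      using b that by (auto simp: bij_betw_def)
    have "x \<in> ?F \<union> (\<Union>j\<in>{1..k}. G (b j))" if x: "x \<in> topspace X" for x
    proof (cases "x \<in> ?F")
      case False
      then have bd: "- real N \<le> flow_integral \<omega> \<phi> x t" if "0 \<le> t" for t
        using x that by force
      obtain p where p: "p \<in> Fix" "limitin X (\<lambda>t. \<phi> (x, t)) p at_top"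
        using bounded_descent_converges[OF x bd] by metis
      then have "p \<in> b ` {1..k}" using b by (simp add: bij_betw_def)
      then obtain j where "j \<in> {1..k}" "p = b j" by blast
      then show ?thesis using G[OF p(1)] p(2) x bd by blast
    qed auto
    moreover have "?F \<subseteq> topspace X" by auto
    moreover have "G (b j) \<subseteq> topspace X" if "j \<in> {1..k}" for j
      using G[OF bF[OF that]] openin_subset by blast
    ultimately have "topspace X = ?F \<union> (\<Union>j\<in>{1..k}. G (b j))" by blast
    then show ?thesis
      using movable_below_descent[of \<omega> "real N"] G bF
      by (intro exI[of _ ?F] exI[of _ "\<lambda>j. G (b j)"]) (auto simp: flow_integral_def)
  qed
  \<comment> \<open>The form \<omega> itself is the representative, so the least number is at most
    \<open>k\<close>.\<close>
  then have "cat_class X \<xi> \<le> k"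
    unfolding cat_class_def by (intro Least_le exI[of _ \<omega>]) (use assms(3) in blast)
  then show False using assms(8) by simp
qed

end
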